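(* Let $q$ be a complex number with $|q|<1$, and let $a,b,c,x$ be complex numbers such that $\max\{|aq/bcx|,\,|aqx/bc|\}<1$. Then $$ {}_2\psi_2\left[\begin{matrix} b, c \\ aq/b, aq/c \end{matrix} ; q, \frac{aqx}{bc} \right] = \frac{(q/a, aq/bc, q/bx, q/cx, qx, aqx^2; q)_\infty}{(q/b, q/c, aq/bcx, q/ax, aqx, qx^2; q)_\infty} \times {}_8\psi_8\left[\begin{matrix} q(ax)^{\frac{1}{2}}, -q(ax)^{\frac{1}{2}}, (aq)^{\frac{1}{2}}, -(aq)^{\frac{1}{2}}, a^{\frac{1}{2}}, -a^{\frac{1}{2}}, bx, cx \\ (ax)^{\frac{1}{2}}, -(ax)^{\frac{1}{2}}, x(aq)^{\frac{1}{2}}, -x(aq)^{\frac{1}{2}}, xqa^{\frac{1}{2}}, -xqa^{\frac{1}{2}}, aq/b, aq/c \end{matrix} ; q, \frac{aqx}{bc} \right]. $$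
   Context: For $|q|<1$, integer $n$ and complex $x$: $(x;q)_\infty=\prod_{i\ge 0}(1-xq^i)$, $(x;q)_n=(x;q)_\infty/(xq^n;q)_\infty$, and $(x_1,\dots,x_r;q)_n=(x_1;q)_n\cdots(x_r;q)_n$ (also for $n=\infty$). The bilateral series is ${}_r\psi_r\left[\begin{matrix} a_1,\dots,a_r\\ b_1,\dots,b_r\end{matrix};q,z\right]=\sum_{k=-\infty}^{\infty}\frac{(a_1,\dots,a_r;q)_k}{(b_1,\dots,b_r;q)_k}z^k$. Square roots denote fixed choices of branch (e.g. $(ax)^{1/2}$, $a^{1/2}$, $(aq)^{1/2}$), used consistently. Parameters are assumed such that all denominators are nonzero. *)

theory Defs
  imports "HOL-Analysis.Analysis"
begin

definition qpoch_inf :: "complex \<Rightarrow> complex \<Rightarrow> complex" where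
  "qpoch_inf x q = (\<Prod>i. 1 - x * q ^ i)"

definition qpochs_inf :: "complex list \<Rightarrow> complex \<Rightarrow> complex" where
  "qpochs_inf xs q = (\<Prod>x\<leftarrow>xs. qpoch_inf x q)"

text \<open>
  The symbol \<open>(x;q)\<^sub>n\<close> for an integer \<open>n\<close> is the quotient of \<open>(x;q)\<^sub>\<infinity>\<close> by
  \<open>(xq\<^sup>n;q)\<^sub>\<infinity>\<close>. We define it by the finite product that remains after cancelling common
  factors, so that it also has its usual value when the quotient reads 0/0, that is, when \<open>x\<close> and
  \<open>xq\<^sup>n\<close> are both of the form \<open>q\<^sup>-\<^sup>m\<close> with \<open>m \<ge> 0\<close>. The quotient formula is lemma
  \<open>qpoch_eq_quotient\<close> below. Where \<open>(x;q)\<^sub>n\<close> has a pole (\<open>x = q\<^sup>j\<close> with \<open>1 \<le> j \<le> -n\<close>), the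
  value of \<open>qpoch\<close>, and hence of its reciprocal, is 0; for the reciprocal this is the usual
  convention, as in \<open>1/(q;q)\<^sub>-\<^sub>1 = 0\<close>.
\<close>

definition qpoch :: "complex \<Rightarrow> complex \<Rightarrow> int \<Rightarrow> complex" where
  "qpoch x q n =
     (if n \<ge> 0 then \<Prod>i<nat n. 1 - x * q ^ i
      else 1 / (\<Prod>i<nat (-n). 1 - x * q powi (n + int i)))"

definition qpochs :: "complex list \<Rightarrow> complex \<Rightarrow> int \<Rightarrow> complex" where
  "qpochs xs q n = (\<Prod>x\<leftarrow>xs. qpoch x q n)"

text \<open>The bilateral series with numerator parameters \<open>as\<close> and denominator parameters \<open>bs\<close>.\<close>

definition bilateral_psi ::
    "complex list \<Rightarrow> complex list \<Rightarrow> complex \<Rightarrow> complex \<Rightarrow> complex" where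
  "bilateral_psi as bs q z =
     (\<Sum>\<^sub>\<infinity>k::int. qpochs as q k / qpochs bs q k * z powi k)"

text \<open>
  No term of the series has a zero factor in a denominator: such a factor can only come from
  \<open>(b;q)\<^sub>k\<close> with \<open>k > 0\<close> for a lower parameter, or from \<open>(a;q)\<^sub>k\<close> with \<open>k < 0\<close> for an upper one.
\<close>

definition bilateral_nonsingular :: "complex list \<Rightarrow> complex list \<Rightarrow> complex \<Rightarrow> bool" where
  "bilateral_nonsingular as bs q \<longleftrightarrow>
     (\<forall>a\<in>set as. \<forall>n\<ge>1. 1 - a * q powi (- int n) \<noteq> 0) \<and>
     (\<forall>b\<in>set bs. \<forall>n. 1 - b * q ^ n \<noteq> 0)"

lemma convergent_prod_qpoch:
  assumes "norm q < 1"
  shows "convergent_prod (\<lambda>i. 1 - x * q ^ i :: complex)"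
proof -
  have "summable (\<lambda>i. norm (- x) * norm q ^ i)"
    using assms by (intro summable_mult summable_geometric) auto
  hence "summable (\<lambda>i. norm (- x * q ^ i))"
    by (simp add: norm_mult norm_power)
  hence "abs_convergent_prod (\<lambda>i. 1 - x * q ^ i)"
    by (simp add: abs_convergent_prod_conv_summable)
  thus ?thesis
    by (rule abs_convergent_prod_imp_convergent_prod)
qed

lemma qpoch_inf_split:
  assumes "norm q < 1"
  shows "qpoch_inf x q = (\<Prod>i<n. 1 - x * q ^ i) * qpoch_inf (x * q ^ n) q"
proof -
  have "(\<lambda>m. \<Prod>i\<le>m. 1 - x * q ^ i) \<longlonglongrightarrow> qpoch_inf x q" for x
    unfolding qpoch_inf_def by (rule convergent_prod_LIMSEQ[OF convergent_prod_qpoch[OF assms]])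
  note lim = this
  have "(\<lambda>m. \<Prod>i\<le>m + n. 1 - x * q ^ i) \<longlonglongrightarrow> qpoch_inf x q"
    using lim[of x] by (rule LIMSEQ_ignore_initial_segment)
  moreover have "(\<Prod>i\<le>m + n. 1 - x * q ^ i) =
      (\<Prod>i<n. 1 - x * q ^ i) * (\<Prod>i\<le>m. 1 - (x * q ^ n) * q ^ i)" for m
  proof -
    have "(\<Prod>i<k + n. 1 - x * q ^ i) =
        (\<Prod>i<n. 1 - x * q ^ i) * (\<Prod>i<k. 1 - (x * q ^ n) * q ^ i)" for k
    proof (induction k)
      case (Suc k)
      then show ?case by (simp add: power_add mult.assoc mult.commute[of "q ^ n"])
    qed simp
    from this[of "Suc m"] show ?thesis
      by (simp add: lessThan_Suc_atMost)
  qed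
  ultimately have "(\<lambda>m. (\<Prod>i<n. 1 - x * q ^ i) * (\<Prod>i\<le>m. 1 - (x * q ^ n) * q ^ i))
      \<longlonglongrightarrow> qpoch_inf x q" by simp
  moreover have "(\<lambda>m. (\<Prod>i<n. 1 - x * q ^ i) * (\<Prod>i\<le>m. 1 - (x * q ^ n) * q ^ i))
      \<longlonglongrightarrow> (\<Prod>i<n. 1 - x * q ^ i) * qpoch_inf (x * q ^ n) q"
    by (intro tendsto_mult_left lim)
  ultimately show ?thesis by (rule LIMSEQ_unique)
qed

lemma qpoch_eq_quotient:
  assumes "norm q < 1" "q \<noteq> 0" "qpoch_inf (x * q powi n) q \<noteq> 0"
  shows "qpoch x q n = qpoch_inf x q / qpoch_inf (x * q powi n) q"
proof (cases "n \<ge> 0")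
  case True
  then show ?thesis
    using qpoch_inf_split[OF assms(1), of x "nat n"] assms(3)
    by (simp add: qpoch_def power_int_def)
next
  case False
  define y where "y = x * q powi n"
  have "y * q ^ i = x * q powi (n + int i)" for i
    using assms(2) by (simp add: y_def power_int_add)
  moreover have "y * q ^ nat (-n) = x"
    using False assms(2) by (simp add: y_def power_int_def field_simps)
  ultimately have split: "qpoch_inf y q =
      (\<Prod>i<nat (-n). 1 - x * q powi (n + int i)) * qpoch_inf x q"
    using qpoch_inf_split[OF assms(1), of y "nat (-n)"] by (simp only:)
  have "qpoch_inf y q \<noteq> 0"
    unfolding y_def by (rule assms(3))
  with split have "(\<Prod>i<nat (-n). 1 - x * q powi (n + int i)) \<noteq> 0" "qpoch_inf x q \<noteq> 0"
    by (metis mult_zero_left) (metis split \<open>qpoch_inf y q \<noteq> 0\<close> mult_zero_right)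
  then have "1 / (\<Prod>i<nat (-n). 1 - x * q powi (n + int i)) = qpoch_inf x q / qpoch_inf y q"
    unfolding split by simp
  then show ?thesis
    using False by (simp only: qpoch_def y_def if_False)
qed

end

theory Submission
  imports Defs "HOL-Complex_Analysis.Complex_Analysis"
begin

text \<open>
  Put \<open>\<alpha> = ax\<close>, \<open>u = 1/(bx)\<close>, \<open>v = 1/(cx)\<close> and clear all denominators. The claim becomes
  \<open>(\<alpha>quv, \<alpha>, q/\<alpha>, qx\<^sup>2; q)\<^sub>\<infinity> L(x) = (\<alpha>quvx, qx; q)\<^sub>\<infinity> R(x)\<close>, where for fixed \<open>\<alpha>, u, v\<close> the bilateral
  series \<open>L\<close> and \<open>R\<close> have terms entire in \<open>x\<close> and converge locally uniformly on the disc
  \<open>|\<alpha>quvx\<^sup>2| < 1\<close>. By the identity theorem it suffices to take \<open>x = q\<^sup>N\<close>, since these points accumulate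
  at \<open>0\<close>. There each term of \<open>(\<alpha>quv; q)\<^sub>N L\<close> is, by a terminating very-well-poised \<open>\<^sub>6\<phi>\<^sub>5\<close> summation,
  a combination of \<open>N + 1\<close> consecutive terms of the case \<open>N = 0\<close>. After exchanging the finite inner sum
  with the bilateral one, the new inner sum is evaluated by the q-Chu-Vandermonde formula and yields the
  terms of \<open>R\<close>.
\<close>

subsection \<open>Finite q-identities\<close>

text \<open>Fixing \<open>al\<close>, \<open>u\<close>, \<open>v\<close> instead of
  \<open>a\<close>, \<open>b\<close>, \<open>c\<close> makes \<open>x = 0\<close> an ordinary
  interior point: the condition |aq/(bcx)| < 1 excludes a neighbourhood of 0 when \<open>a\<close>,
  \<open>b\<close>, \<open>c\<close> are fixed, but its left-hand side is
  |\<open>al * q * u * v\<close>|, which is free of \<open>x\<close>. The infinite products of the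
  formula arise from finite ones that depend on \<open>N\<close>. With \<open>x = q^N\<close>, the
  factor (al q u v; q)_N is P(al q u v)/P(al q u v x), and the factor (q^(N+1); q)_N left by
  q-Chu-Vandermonde is P(qx)/P(qx^2). The inner sum also leaves (q/B; q)_N (qB; q)_N in the
  denominator, with B = q^(-2n)/al; quasi-periodicity of the theta product P(al) P(q/al) turns its
  reciprocal into P(q^(1-2n) x/al) P(q^(1+2n) x al), up to elementary factors. This is the origin of
  the doubled index in \<open>rterm\<close>, and in these forms everything makes sense for all
  \<open>x\<close>. The expansion divides by factors 1 - q^m/al, so it requires al q^m different
  from 1 for every integer m. The square roots occur only in pairs of opposite sign, so only their
  squares survive.\<close>

locale q_base =
  fixes q :: complex
  assumes norm_q: "norm q < 1" and q_nz: "q \<noteq> 0"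
begin

definition qpoch_fin :: "complex \<Rightarrow> nat \<Rightarrow> complex" where
  "qpoch_fin y n = (\<Prod>i<n. 1 - y * q ^ i)"

abbreviation P :: "complex \<Rightarrow> complex" where
  "P y \<equiv> qpoch_inf y q"

lemma qpoch_fin_0 [simp]: "qpoch_fin y 0 = 1"
  by (simp add: qpoch_fin_def)

lemma qpoch_fin_Suc: "qpoch_fin y (Suc n) = qpoch_fin y n * (1 - y * q ^ n)"
  by (simp add: qpoch_fin_def)

lemma qpoch_fin_Suc': "qpoch_fin y (Suc n) = (1 - y) * qpoch_fin (y * q) n"
  by (simp add: qpoch_fin_def prod.lessThan_Suc_shift mult.assoc del: prod.lessThan_Suc)

lemma qpoch_fin_add: "qpoch_fin y (m + n) = qpoch_fin y m * qpoch_fin (y * q ^ m) n"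
  by (induction n) (simp_all add: qpoch_fin_Suc power_add mult_ac)

lemma qpoch_fin_nonzero: "(\<And>i. i < n \<Longrightarrow> y * q ^ i \<noteq> 1) \<Longrightarrow> qpoch_fin y n \<noteq> 0"
  by (auto simp: qpoch_fin_def)

lemma P_split: "P y = qpoch_fin y n * P (y * q ^ n)"
  using qpoch_inf_split[OF norm_q] by (simp add: qpoch_fin_def)

lemma P_step: "P y = (1 - y) * P (y * q)"
  using P_split[of y 1] by (simp add: qpoch_fin_Suc)

lemma q_power_ne_1: "n > 0 \<Longrightarrow> q ^ n \<noteq> 1"
  using norm_q power_less_one_iff[of "norm q" n] by (metis norm_ge_zero norm_one norm_power order_less_irrefl)

lemma qpoch_fin_q_nonzero: "qpoch_fin q n \<noteq> 0"
  using q_power_ne_1 by (intro qpoch_fin_nonzero) (metis power_Suc zero_less_Suc)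

text \<open>Each factor \<open>1 - y * q^i\<close> is \<open>- y * q^i\<close> times
  \<open>1 - q^(-i) / y\<close>; the extracted powers of \<open>q\<close> collect to the exponent
  \<open>n choose 2\<close>.\<close>

lemma qpoch_fin_reverse:
  assumes "y \<noteq> 0"
  shows "qpoch_fin y n = (- y) ^ n * q ^ (n choose 2) * qpoch_fin (q powi (1 - int n) / y) n"
proof (induction n)
  case (Suc n)
  have "qpoch_fin (q powi (1 - int (Suc n)) / y) (Suc n) =
      (1 - q powi (- int n) / y) * qpoch_fin (q powi (1 - int n) / y) n"
    using q_nz by (simp add: qpoch_fin_Suc' power_int_diff power_int_minus field_simps)
  moreover have "- y * q ^ n * (1 - q powi (- int n) / y) = 1 - y * q ^ n"
    using q_nz assms by (simp add: power_int_minus field_simps)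
  moreover have "q ^ (Suc n choose 2) = q ^ n * q ^ (n choose 2)"
    by (simp add: numeral_2_eq_2 power_add)
  moreover have "(- y) ^ Suc n * (q ^ n * q ^ (n choose 2)) * ((1 - z) * w) =
      (- y) ^ n * q ^ (n choose 2) * w * (- y * q ^ n * (1 - z))" for z w
    by simp
  ultimately show ?case
    using Suc by (simp only: qpoch_fin_Suc)
qed (simp add: numeral_2_eq_2)

section \<open>q-binomial coefficients and two finite summations\<close>

definition qbin :: "nat \<Rightarrow> nat \<Rightarrow> complex" where
  "qbin n k = (if k \<le> n then qpoch_fin q n / (qpoch_fin q k * qpoch_fin q (n - k)) else 0)"

lemma qbin_0 [simp]: "qbin n 0 = 1"
  by (simp add: qbin_def qpoch_fin_q_nonzero)

lemma qbin_gt [simp]: "n < k \<Longrightarrow> qbin n k = 0"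
  by (simp add: qbin_def)

lemma qbin_Suc_Suc_aux:
  assumes "k \<le> n"
  shows "qbin (Suc n) (Suc k) * (1 - q ^ Suc k) = qbin n k * (1 - q ^ Suc n)"
    and "qbin n (Suc k) * (1 - q ^ Suc k) = qbin n k * (1 - q ^ (n - k))"
proof -
  show "qbin (Suc n) (Suc k) * (1 - q ^ Suc k) = qbin n k * (1 - q ^ Suc n)"
    using assms q_power_ne_1[of "Suc k"] by (simp add: qbin_def qpoch_fin_Suc qpoch_fin_q_nonzero field_simps)
  show "qbin n (Suc k) * (1 - q ^ Suc k) = qbin n k * (1 - q ^ (n - k))"
  proof (cases "k < n")
    case True
    then obtain d where d: "n = Suc (k + d)"
      using less_iff_Suc_add by auto
    have "qpoch_fin q (Suc k) = qpoch_fin q k * (1 - q ^ Suc k)" "qpoch_fin q (Suc d) = qpoch_fin q d * (1 - q ^ Suc d)"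
      by (simp_all add: qpoch_fin_Suc)
    then show ?thesis
      using q_power_ne_1[of "Suc k"] q_power_ne_1[of "Suc d"] qpoch_fin_q_nonzero[of k] qpoch_fin_q_nonzero[of d]
      by (simp add: qbin_def d Suc_diff_le del: power_Suc)
  next
    case False
    then show ?thesis using assms by simp
  qed
qed

text \<open>Both forms of Pascal's rule are wanted: \<open>conn_coeff_rec\<close> subtracts a
  multiple of the second from the first.\<close>

lemma qbin_pascal:
  assumes "k \<le> n"
  shows "qbin (Suc n) (Suc k) = qbin n (Suc k) + q ^ (n - k) * qbin n k"
    and "qbin (Suc n) (Suc k) = q ^ Suc k * qbin n (Suc k) + qbin n k"
proof -
  have nz: "1 - q ^ Suc k \<noteq> 0"
    using q_power_ne_1[of "Suc k"] by simp
  have *: "q ^ Suc n = q ^ (n - k) * q ^ Suc k"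
    using assms by (simp flip: power_add)
  note aux = qbin_Suc_Suc_aux[OF assms]
  have "qbin (Suc n) (Suc k) * (1 - q ^ Suc k) =
      (qbin n (Suc k) + q ^ (n - k) * qbin n k) * (1 - q ^ Suc k)"
    unfolding distrib_right aux * mult.assoc by (simp add: algebra_simps)
  then show "qbin (Suc n) (Suc k) = qbin n (Suc k) + q ^ (n - k) * qbin n k"
    using nz by (simp only: mult_cancel_right) simp
  have "qbin (Suc n) (Suc k) * (1 - q ^ Suc k) =
      q ^ Suc k * (qbin n (Suc k) * (1 - q ^ Suc k)) + qbin n k * (1 - q ^ Suc k)"
    unfolding aux * by (simp add: algebra_simps)
  then have "qbin (Suc n) (Suc k) * (1 - q ^ Suc k) =
      (q ^ Suc k * qbin n (Suc k) + qbin n k) * (1 - q ^ Suc k)"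
    by (simp only: distrib_right mult.assoc)
  then show "qbin (Suc n) (Suc k) = q ^ Suc k * qbin n (Suc k) + qbin n k"
    using nz by (simp only: mult_cancel_right) simp
qed

text \<open>This is the sum of 2phi1(q^(-N), b; bd; q, d q^N), multiplied by (bd; q)_N so that it is
  polynomial in \<open>b\<close> and \<open>d\<close>. Pascal's rule splits case N + 1 into
  \<open>1 - b d q^N\<close> times case N at \<open>b\<close> and \<open>- d q^N (1 - b)\<close>
  times case N at \<open>b q\<close>. Both cases have the same value, and the two weights add up to
  \<open>1 - d q^N\<close>.\<close>

lemma q_Chu_Vandermonde:
  "(\<Sum>m\<le>N. qbin N m * q ^ (m choose 2) * (- d) ^ m * qpoch_fin b m * qpoch_fin (b * d * q ^ m) (N - m)) = qpoch_fin d N"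
proof (induction N arbitrary: b)
  case (Suc N)
  let ?t = "\<lambda>N b m. qbin N m * q ^ (m choose 2) * (- d) ^ m * qpoch_fin b m * qpoch_fin (b * d * q ^ m) (N - m)"
  \<comment> \<open>The part of Pascal's rule that keeps \<open>b\<close>. Its last product is one
    factor longer than in case N, and the extra factor \<open>1 - b * d * q^N\<close> does not
    depend on \<open>m\<close>.\<close>
  let ?g = "\<lambda>m. qbin N m * q ^ (m choose 2) * (- d) ^ m * qpoch_fin b m * qpoch_fin (b * d * q ^ m) (Suc N - m)"
  have g: "?g m = (1 - b * d * q ^ N) * ?t N b m" if "m \<le> N" for m
    using that by (simp add: Suc_diff_le qpoch_fin_Suc mult_ac flip: power_add)
  have step: "?t (Suc N) b (Suc m) = ?g (Suc m) + (- d * q ^ N * (1 - b)) * ?t N (b * q) m"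
    if m: "m \<le> N" for m
  proof -
    have qq: "q ^ (N - m) * q ^ (Suc m choose 2) = q ^ N * q ^ (m choose 2)"
      using m by (simp add: numeral_2_eq_2 flip: power_add)
    have qfm: "qpoch_fin b (Suc m) = (1 - b) * qpoch_fin (b * q) m"
      by (rule qpoch_fin_Suc')
    have arg: "b * d * q ^ Suc m = b * q * d * q ^ m"
      by simp
    have "?t (Suc N) b (Suc m) = ?g (Suc m) +
       (q ^ (N - m) * q ^ (Suc m choose 2)) * qbin N m * (- d) ^ Suc m * qpoch_fin b (Suc m) *
         qpoch_fin (b * d * q ^ Suc m) (N - m)"
      unfolding qbin_pascal(1)[OF m] by (simp add: algebra_simps del: power_Suc)
    also have "(q ^ (N - m) * q ^ (Suc m choose 2)) * qbin N m * (- d) ^ Suc m * qpoch_fin b (Suc m) *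
         qpoch_fin (b * d * q ^ Suc m) (N - m) = (- d * q ^ N * (1 - b)) * ?t N (b * q) m"
      unfolding qq qfm arg by simp
    finally show ?thesis .
  qed
  have "(\<Sum>m\<le>Suc N. ?t (Suc N) b m) = ?t (Suc N) b 0 + (\<Sum>m\<le>N. ?t (Suc N) b (Suc m))"
    by (rule sum.atMost_Suc_shift)
  also have "(\<Sum>m\<le>N. ?t (Suc N) b (Suc m)) =
      (\<Sum>m\<le>N. ?g (Suc m)) + (- d * q ^ N * (1 - b)) * (\<Sum>m\<le>N. ?t N (b * q) m)"
    unfolding sum_distrib_left sum.distrib[symmetric] by (intro sum.cong refl step) simp
  also have "(\<Sum>m\<le>N. ?t N (b * q) m) = qpoch_fin d N"
    by (rule Suc)
  also have "?t (Suc N) b 0 + ((\<Sum>m\<le>N. ?g (Suc m)) + (- d * q ^ N * (1 - b)) * qpoch_fin d N) =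
      (\<Sum>m\<le>Suc N. ?g m) + (- d * q ^ N * (1 - b)) * qpoch_fin d N"
    unfolding sum.atMost_Suc_shift[of ?g] by simp
  also have "(\<Sum>m\<le>Suc N. ?g m) = (\<Sum>m\<le>N. ?g m)"
    by simp
  also have "\<dots> = (1 - b * d * q ^ N) * (\<Sum>m\<le>N. ?t N b m)"
    unfolding sum_distrib_left by (intro sum.cong refl g) simp
  also have "(\<Sum>m\<le>N. ?t N b m) = qpoch_fin d N"
    by (rule Suc)
  finally show ?case
    by (simp add: qpoch_fin_Suc algebra_simps)
qed (simp add: numeral_2_eq_2)

text \<open>After multiplication by the denominator on the right, every summand is a
  q-Chu-Vandermonde term with b = q^(-N)/B and d = q^(N+1), so that bd = q/B. The assumption on
  \<open>B\<close> keeps all denominators away from 0.\<close>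

lemma partial_fraction_sum:
  assumes "B \<noteq> 0" and B: "\<And>m::int. B * q powi m \<noteq> 1"
  shows "(\<Sum>j\<le>N. qbin N j * (- 1) ^ j * q ^ (j choose 2) * (1 - B) / qpoch_fin (B * q powi (- int j)) (Suc N))
    = qpoch_fin (q ^ Suc N) N / (qpoch_fin (q / B) N * qpoch_fin (q * B) N)"
proof -
  have powi_nat: "B * q powi m * q ^ i \<noteq> 1" for m i
    using B[of "m + int i"] q_nz by (simp add: power_int_add mult.assoc)
  have qB: "q * B * q ^ i \<noteq> 1" for i
    using B[of "int (Suc i)"] unfolding power_int_of_nat by (simp add: mult_ac)
  have qB': "q / B * q ^ i \<noteq> 1" for i
    using B[of "- int (Suc i)"] assms(1) q_nz unfolding power_int_minus power_int_of_nat
    by (simp add: field_simps)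
  have nz: "qpoch_fin (q / B) N \<noteq> 0" "qpoch_fin (q * B) N \<noteq> 0"
    using qB qB' by (auto intro!: qpoch_fin_nonzero)
  let ?b = "q powi (- int N) / B" and ?d = "q ^ Suc N"
  have bd: "?b * ?d = q / B"
    using q_nz by (simp add: power_int_minus field_simps)
  have "qbin N j * (- 1) ^ j * q ^ (j choose 2) * (1 - B) / qpoch_fin (B * q powi (- int j)) (Suc N) *
        (qpoch_fin (q / B) N * qpoch_fin (q * B) N) =
        qbin N j * q ^ (j choose 2) * (- ?d) ^ j * qpoch_fin ?b j * qpoch_fin (?b * ?d * q ^ j) (N - j)"
    if j: "j \<le> N" for j
  proof -
    define C where "C = q ^ (j choose 2)"
    have [simp]: "C \<noteq> 0" by (simp add: C_def q_nz)
    have Bj: "B * q powi (- int j) * q ^ j = B"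
      using q_nz by (simp add: power_int_minus)
    have r1: "qpoch_fin (B * q powi (- int j)) j = (- (B * q powi (- int j))) ^ j * C * qpoch_fin (q / B) j"
    proof -
      have "q powi (1 - int j) / (B * q powi (- int j)) = q / B"
        using q_nz by (simp add: power_int_diff power_int_minus field_simps)
      then show ?thesis
        using qpoch_fin_reverse[of "B * q powi (- int j)" j] assms(1) q_nz by (simp add: C_def)
    qed
    \<comment> \<open>The last \<open>j\<close> factors of \<open>qpoch_fin (q * B) N\<close> are
      not cancelled by the summand's denominator; reversed, they supply
      \<open>qpoch_fin ?b j\<close>.\<close>
    have r2: "qpoch_fin (q * B * q ^ (N - j)) j = (- (q * B * q ^ (N - j))) ^ j * C * qpoch_fin ?b j"
    proof -
      have "q powi (1 - int j) / (q * B * q ^ (N - j)) = ?b"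
        using q_nz j by (simp add: power_int_diff power_int_minus field_simps flip: power_add)
      then show ?thesis
        using qpoch_fin_reverse[of "q * B * q ^ (N - j)" j] assms(1) q_nz by (simp add: C_def)
    qed
    have s1: "qpoch_fin (B * q powi (- int j)) (Suc N) =
        qpoch_fin (B * q powi (- int j)) j * (1 - B) * qpoch_fin (q * B) (N - j)"
    proof -
      have "Suc N = j + Suc (N - j)" using j by simp
      then have "qpoch_fin (B * q powi (- int j)) (Suc N) = qpoch_fin (B * q powi (- int j)) (j + Suc (N - j))"
        by (rule arg_cong)
      then show ?thesis
        unfolding qpoch_fin_add Bj qpoch_fin_Suc' by (simp add: mult_ac)
    qed
    have s2: "qpoch_fin (q * B) N = qpoch_fin (q * B) (N - j) * qpoch_fin (q * B * q ^ (N - j)) j"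
      using qpoch_fin_add[of "q * B" "N - j" j] j by simp
    have s3: "qpoch_fin (q / B) N = qpoch_fin (q / B) j * qpoch_fin (q / B * q ^ j) (N - j)"
      using qpoch_fin_add[of "q / B" j "N - j"] j by simp
    have nzs: "qpoch_fin (q * B) (N - j) \<noteq> 0" "qpoch_fin (q / B) j \<noteq> 0" "1 - B \<noteq> 0"
      using qB qB' B[of 0] by (auto intro!: qpoch_fin_nonzero)
    have pw: "(- (q * B * q ^ (N - j))) ^ j = (- (B * q powi (- int j))) ^ j * ?d ^ j"
    proof -
      have "- (q * B * q ^ (N - j)) = - (B * q powi (- int j)) * ?d"
        using q_nz j by (simp add: power_int_minus field_simps flip: power_add)
      then show ?thesis by (simp only: power_mult_distrib)
    qed
    have nzp: "(- (B * q powi (- int j))) ^ j \<noteq> 0"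
      using assms(1) q_nz by simp
    have signs: "(- 1) ^ j * ?d ^ j = (- ?d) ^ j"
      by (simp only: mult_minus1 flip: power_mult_distrib)
    have cancel: "g * s * C * (1 - B) / (p * C * x * (1 - B) * y) * (x * z * (y * (p * D * C * w))) =
        g * C * (s * D) * w * z" if "p \<noteq> 0" "x \<noteq> 0" "y \<noteq> 0" for g s p x y z w D :: complex
      using that nzs(3) \<open>C \<noteq> 0\<close> by (simp add: divide_simps)
    show ?thesis
      unfolding bd s1 s2 s3 r1 r2 pw C_def[symmetric] cancel[OF nzp nzs(2,1)] signs ..
  qed
  then have "(\<Sum>j\<le>N. qbin N j * (- 1) ^ j * q ^ (j choose 2) * (1 - B) / qpoch_fin (B * q powi (- int j)) (Suc N))
      * (qpoch_fin (q / B) N * qpoch_fin (q * B) N) = qpoch_fin ?d N"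
    unfolding sum_distrib_right
    by (subst q_Chu_Vandermonde[of N ?d ?b, symmetric]) (intro sum.cong, auto)
  then show ?thesis
    using nz by (simp add: field_simps)
qed

subsection \<open>The terminating well-poised expansion\<close>

text \<open>Since 1/(A q^j; q)_(N+1) = (A; q)_j / ((A; q)_(N+1) (A q^(N+1); q)_j), this is the
  very-well-poised part of a 6phi5 term with base \<open>A\<close> and terminating parameter q^(-N).
  The two remaining parameter pairs are carried by \<open>quad\<close>.\<close>

definition conn_coeff :: "nat \<Rightarrow> nat \<Rightarrow> complex \<Rightarrow> complex" where
  "conn_coeff N j A =
     qbin N j * (- A) ^ j * q ^ (j ^ 2 + (j choose 2)) * (1 - A * q ^ (2 * j)) / qpoch_fin (A * q ^ j) (Suc N)"

text \<open>This mirrors \<open>quad_step\<close>: with A = q^(-2k)/al, lowering \<open>k\<close> by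
  one replaces \<open>A\<close> by \<open>A * q^2\<close>. Once the common factors are removed, it
  is the first Pascal rule minus \<open>A * q^(N+1)\<close> times the second.\<close>

lemma conn_coeff_rec:
  assumes A: "\<And>i. A * q ^ i \<noteq> 1" and j: "j \<le> N"
  shows "(1 - A * q ^ Suc N) * conn_coeff (Suc N) (Suc j) A =
    conn_coeff N (Suc j) A - A * q ^ Suc N * conn_coeff N j (A * q ^ 2)"
proof -
  define D where "D = qpoch_fin (A * q ^ Suc j * q) N"
  define X where "X = 1 - A * q ^ Suc j"
  define Y where "Y = 1 - A * q ^ (N + j + 2)"
  have "D \<noteq> 0" "X \<noteq> 0" "Y \<noteq> 0"
    using A[of "j + 2 + i" for i] A[of "Suc j"] A[of "N + j + 2"]
    unfolding D_def X_def Y_def by (auto intro!: qpoch_fin_nonzero simp: power_add power2_eq_square mult_ac)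
  have 1: "qpoch_fin (A * q ^ Suc j) (Suc (Suc N)) = X * D * Y"
    unfolding qpoch_fin_Suc[of _ "Suc N"] qpoch_fin_Suc'[of _ N]
    by (simp add: X_def D_def Y_def power_add power2_eq_square mult_ac)
  have 2: "qpoch_fin (A * q ^ Suc j) (Suc N) = X * D"
    unfolding qpoch_fin_Suc' by (simp add: X_def D_def)
  have 3: "qpoch_fin (A * q ^ 2 * q ^ j) (Suc N) = D * Y"
    unfolding qpoch_fin_Suc by (simp add: D_def Y_def power_add power2_eq_square mult_ac)
  define E where "E = (- A) ^ Suc j * q ^ ((Suc j) ^ 2 + (Suc j choose 2)) * (1 - A * q ^ (2 * Suc j))"
  have exps: "(Suc j) ^ 2 + (Suc j choose 2) + (N - j) = Suc N + (2 * j + (j ^ 2 + (j choose 2)))"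
    using j by (simp add: numeral_2_eq_2)
  have E': "A * q ^ Suc N * ((- (A * q ^ 2)) ^ j * q ^ (j ^ 2 + (j choose 2)) * (1 - A * q ^ 2 * q ^ (2 * j)))
      = - (q ^ (N - j)) * E"
  proof -
    have "(- (A * q ^ 2)) ^ j = (- A) ^ j * q ^ (2 * j)"
      by (metis mult_minus_left power_mult power_mult_distrib)
    then have "A * q ^ Suc N * ((- (A * q ^ 2)) ^ j * q ^ (j ^ 2 + (j choose 2)) * (1 - A * q ^ 2 * q ^ (2 * j)))
      = A * (- A) ^ j * q ^ (Suc N + (2 * j + (j ^ 2 + (j choose 2)))) * (1 - A * q ^ (2 * Suc j))"
      by (simp add: power_add mult_ac power2_eq_square)
    also have "\<dots> = - (q ^ (N - j)) * E"
      unfolding exps[symmetric] power_add E_def by simp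
    finally show ?thesis .
  qed
  have "q ^ (N - j) * q ^ Suc j = q ^ Suc N"
    using j by (simp flip: power_add)
  moreover have "q ^ (N + j + 2) = q ^ Suc N * q ^ Suc j"
    by (simp add: power_add)
  moreover have "(1 - A * q ^ Suc N) * qbin (Suc N) (Suc j) =
     (qbin N (Suc j) + q ^ (N - j) * qbin N j) -
       A * q ^ Suc N * (q ^ Suc j * qbin N (Suc j) + qbin N j)"
    unfolding qbin_pascal(1)[OF j, symmetric] qbin_pascal(2)[OF j, symmetric] by (simp add: algebra_simps)
  ultimately have main: "(1 - A * q ^ Suc N) * qbin (Suc N) (Suc j) = qbin N (Suc j) * Y + q ^ (N - j) * qbin N j * X"
    unfolding X_def Y_def by (simp add: algebra_simps del: power_Suc)
  have "(1 - A * q ^ Suc N) * conn_coeff (Suc N) (Suc j) A =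
      ((1 - A * q ^ Suc N) * qbin (Suc N) (Suc j)) * E / (X * D * Y)"
    unfolding conn_coeff_def 1 E_def by (simp add: mult_ac del: power_Suc)
  also have "\<dots> = qbin N (Suc j) * E / (X * D) - qbin N j * (- (q ^ (N - j)) * E) / (D * Y)"
    unfolding main using \<open>D \<noteq> 0\<close> \<open>X \<noteq> 0\<close> \<open>Y \<noteq> 0\<close> by (simp add: divide_simps) (simp add: algebra_simps)
  also have "qbin N (Suc j) * E / (X * D) = conn_coeff N (Suc j) A"
    unfolding conn_coeff_def 2 E_def by (simp add: mult_ac del: power_Suc)
  also have "qbin N j * (- (q ^ (N - j)) * E) / (D * Y) = A * q ^ Suc N * conn_coeff N j (A * q ^ 2)"
    unfolding conn_coeff_def 3 E'[symmetric] by (simp add: mult_ac del: power_Suc)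
  finally show ?thesis .
qed

lemma conn_coeff_0:
  assumes A: "\<And>i. A * q ^ i \<noteq> 1"
  shows "(1 - A * q ^ Suc N) * conn_coeff (Suc N) 0 A = conn_coeff N 0 A"
  using A[of "Suc N"] unfolding conn_coeff_def qpoch_fin_Suc[of _ "Suc N"] by (simp add: numeral_2_eq_2)

text \<open>The infinite products in the k-th left-hand term at \<open>x = q^N\<close> (see
  \<open>lterm_power\<close>). In the two factors that contain \<open>N\<close>, raising
  \<open>N\<close> and lowering \<open>k\<close> have the same effect, which makes a two-term
  recurrence possible.\<close>

definition quad :: "complex \<Rightarrow> complex \<Rightarrow> complex \<Rightarrow> nat \<Rightarrow> int \<Rightarrow> complex" where
  "quad al u v N k = P (q powi (1 - k + int N) * u) * P (q powi (1 - k + int N) * v) *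
     P (al * q powi (1 + k) * u) * P (al * q powi (1 + k) * v)"

text \<open>The terms linear in \<open>u\<close> and \<open>v\<close> cancel, which leaves a multiple of \<open>1 - \<alpha>q\<^sup>N\<^sup>+\<^sup>1uv\<close>.\<close>

lemma quad_step:
  fixes k :: int
  assumes "al \<noteq> 0"
  defines "A \<equiv> q powi (- 2 * k) / al"
  shows "(1 - al * q ^ Suc N * u * v) * (1 - A * q ^ Suc N) * quad al u v (Suc N) k =
    quad al u v N k - A * q ^ Suc N * quad al u v N (k - 1)"
proof -
  \<comment> \<open>In these variables \<open>A * q^(N+1)\<close> is y/w and
    \<open>al * q^(N+1)\<close> is yw, and the claim reduces to (1 - yu)(1 - yv) - (y/w)(1 - wu)(1 -
    wv) = (1 - y/w)(1 - ywuv).\<close>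
  define y w where "y = q powi (1 - k + int N)" and "w = al * q powi k"
  have "w \<noteq> 0" using assms q_nz by (simp add: w_def)
  have e: "q powi (1 - k + int (Suc N)) = y * q" "q powi (1 - (k - 1) + int N) = y * q"
    "al * q powi (1 + k) = w * q" "al * q powi (1 + (k - 1)) = w"
    using q_nz by (simp_all add: y_def w_def power_int_add power_int_diff field_simps) (simp_all add: power2_eq_square)
  have A': "A = 1 / (al * (q powi k * q powi k))"
  proof -
    have "- 2 * k = - (k + k)" by simp
    then have "q powi (- 2 * k) = inverse (q powi k * q powi k)"
      by (simp only: power_int_minus power_int_add[OF disjI1[OF q_nz]])
    then show ?thesis by (simp add: A_def field_simps)
  qed
  have y': "y = q * q ^ N / q powi k"
    using q_nz by (simp add: y_def power_int_add power_int_diff)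
  have yw: "A * q ^ Suc N = y / w" "al * q ^ Suc N = y * w"
    using q_nz assms(1) by (simp_all add: A' y' w_def field_simps)
  have s: "P (y * u) = (1 - y * u) * P (y * q * u)" "P (y * v) = (1 - y * v) * P (y * q * v)"
    "P (w * u) = (1 - w * u) * P (w * q * u)" "P (w * v) = (1 - w * v) * P (w * q * v)"
    using P_step[of "y * u"] P_step[of "y * v"] P_step[of "w * u"] P_step[of "w * v"]
    by (simp_all add: mult_ac)
  show ?thesis
    unfolding quad_def e yw y_def[symmetric] s using \<open>w \<noteq> 0\<close> by (simp add: divide_simps) algebra
qed

text \<open>This is the terminating \<open>\<^sub>6\<phi>\<^sub>5\<close> summation with base \<open>q\<^sup>-\<^sup>2\<^sup>k/\<alpha>\<close>, cleared of denominators.\<close>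

lemma quad_connection:
  assumes "al \<noteq> 0" and al: "\<And>m::int. al * q powi m \<noteq> 1"
  shows "qpoch_fin (al * q * u * v) N * quad al u v N k =
    (\<Sum>j\<le>N. conn_coeff N j (q powi (- 2 * k) / al) * quad al u v 0 (k - int j))"
proof (induction N arbitrary: k)
  case 0
  have "q powi - (2 * k) \<noteq> al"
    using al[of "2 * k"] q_nz assms(1) by (auto simp: power_int_minus field_simps)
  then show ?case using assms(1)
    by (simp add: conn_coeff_def qpoch_fin_Suc) (simp add: numeral_2_eq_2)
next
  case (Suc N)
  define A where "A = q powi (- 2 * k) / al"
  let ?q = "\<lambda>j. quad al u v 0 (k - int j)"
  have A: "A * q ^ i \<noteq> 1" for i
  proof
    assume "A * q ^ i = 1"
    then have "q powi int i * q powi (- 2 * k) = al"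
      using assms(1) by (simp add: A_def field_simps)
    then have "q powi (int i + - 2 * k) = al"
      using q_nz by (simp add: power_int_diff power_int_minus field_simps)
    then have "al * q powi (2 * k - int i) = 1"
      using q_nz by (auto simp flip: power_int_add)
    then show False using al by blast
  qed
  have A2: "q powi (- 2 * (k - 1)) / al = A * q ^ 2"
    using q_nz by (simp add: A_def power_int_diff power_int_minus field_simps)
  have "(1 - A * q ^ Suc N) * (qpoch_fin (al * q * u * v) (Suc N) * quad al u v (Suc N) k) =
      qpoch_fin (al * q * u * v) N * ((1 - al * q ^ Suc N * u * v) * (1 - A * q ^ Suc N) * quad al u v (Suc N) k)"
    unfolding qpoch_fin_Suc by (simp add: mult_ac)
  also have "\<dots> = qpoch_fin (al * q * u * v) N * quad al u v N k -
      A * q ^ Suc N * (qpoch_fin (al * q * u * v) N * quad al u v N (k - 1))"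
    unfolding quad_step[OF assms(1), of N u v k, folded A_def] by (simp add: algebra_simps)
  also have "\<dots> = (\<Sum>j\<le>N. conn_coeff N j A * ?q j) -
      A * q ^ Suc N * (\<Sum>j\<le>N. conn_coeff N j (A * q ^ 2) * ?q (Suc j))"
    unfolding Suc A2 A_def[symmetric] by (simp add: algebra_simps)
  \<comment> \<open>The added term \<open>j = Suc N\<close> is 0 because
    \<open>qbin N (Suc N) = 0\<close>; the two sums can now be merged after a shift of the second
    one.\<close>
  also have "(\<Sum>j\<le>N. conn_coeff N j A * ?q j) = (\<Sum>j\<le>Suc N. conn_coeff N j A * ?q j)"
    by (simp add: conn_coeff_def)
  also have "\<dots> = conn_coeff N 0 A * ?q 0 + (\<Sum>j\<le>N. conn_coeff N (Suc j) A * ?q (Suc j))"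
    by (rule sum.atMost_Suc_shift)
  also have "conn_coeff N 0 A * ?q 0 + (\<Sum>j\<le>N. conn_coeff N (Suc j) A * ?q (Suc j)) -
        A * q ^ Suc N * (\<Sum>j\<le>N. conn_coeff N j (A * q ^ 2) * ?q (Suc j)) =
      conn_coeff N 0 A * ?q 0 + (\<Sum>j\<le>N. (conn_coeff N (Suc j) A -
        A * q ^ Suc N * conn_coeff N j (A * q ^ 2)) * ?q (Suc j))"
    by (simp add: sum_distrib_left sum_subtractf algebra_simps)
  also have "\<dots> = (1 - A * q ^ Suc N) * conn_coeff (Suc N) 0 A * ?q 0 +
      (\<Sum>j\<le>N. (1 - A * q ^ Suc N) * conn_coeff (Suc N) (Suc j) A * ?q (Suc j))"
    by (intro arg_cong2[of _ _ _ _ "(+)"] sum.cong refl)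
       (use conn_coeff_rec[OF A] conn_coeff_0[OF A] in auto)
  also have "\<dots> = (1 - A * q ^ Suc N) * (\<Sum>j\<le>Suc N. conn_coeff (Suc N) j A * ?q j)"
    unfolding sum.atMost_Suc_shift[of _ N] by (simp add: sum_distrib_left algebra_simps del: power_Suc)
  finally show ?case
    using A[of "Suc N"] unfolding A_def[symmetric] by (simp del: power_Suc)
qed

section \<open>Infinite products and quasi-periodicity of the theta product\<close>

lemma qpoch_inf_nonzero:
  assumes "\<And>i. y * q ^ i \<noteq> 1"
  shows "P y \<noteq> 0"
  unfolding qpoch_inf_def using assms
  by (intro prodinf_nonzero convergent_prod_qpoch norm_q) (metis right_minus_eq)

text \<open>The exponent \<open>k choose 2\<close> continued to negative integers; the integer
  division is exact.\<close>

definition tri :: "int \<Rightarrow> int" where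
  "tri k = k * (k - 1) div 2"

lemma tri_0 [simp]: "tri 0 = 0"
  by (simp add: tri_def)

lemma tri_Suc: "tri (k + 1) = tri k + k"
proof -
  have "(k + 1) * (k + 1 - 1) = k * (k - 1) + k * 2"
    by (simp add: algebra_simps)
  then show ?thesis
    unfolding tri_def by simp
qed

lemma tri_double: "tri (2 * n) = n * (2 * n - 1)"
  unfolding tri_def by simp

text \<open>One step trades the factor \<open>1 - y * q^k\<close> of the first product for
  \<open>1 - q^(-k) / y\<close> in the second, at the price of \<open>- y * q^k\<close>. The
  induction runs in both directions from 0.\<close>

lemma theta_shift:
  assumes "y \<noteq> 0"
  shows "P y * P (q / y) = (- y) powi k * q powi tri k * (P (y * q powi k) * P (q powi (1 - k) / y))"
proof -
  have step: "P (y * q powi k) * P (q powi (1 - k) / y) =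
      - y * q powi k * (P (y * q powi (k + 1)) * P (q powi (1 - (k + 1)) / y))" for k
  proof -
    have 1: "P (y * q powi k) = (1 - y * q powi k) * P (y * q powi (k + 1))"
      using P_step[of "y * q powi k"] q_nz by (simp add: power_int_add mult_ac)
    have 2: "P (q powi (- k) / y) = (1 - q powi (- k) / y) * P (q powi (1 - k) / y)"
      using P_step[of "q powi (- k) / y"] q_nz by (simp add: power_int_diff power_int_minus field_simps)
    have 3: "- y * q powi k * (1 - q powi (- k) / y) = 1 - y * q powi k"
      using assms q_nz by (simp add: power_int_minus field_simps)
    have 4: "1 - (k + 1) = - k" by simp
    show ?thesis
      unfolding 1 4 2 3[symmetric] by (simp only: mult_ac)
  qed
  show ?thesis
  proof (induction k rule: int_induct[of _ 0])
    case (step1 k)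
    then show ?case unfolding step[of k] using q_nz assms
      by (simp add: tri_Suc power_int_add mult_ac)
  next
    case (step2 k)
    have "tri k = tri (k - 1) + (k - 1)"
      using tri_Suc[of "k - 1"] by simp
    moreover have "(- y) powi k = (- y) powi (k - 1) * (- y)" 
      using power_int_add_1[of "- y" "k - 1"] assms by simp
    ultimately show ?case
      using step2 step[of "k - 1"] q_nz by (simp add: power_int_add mult_ac)
  qed simp
qed

subsection \<open>Convergence and holomorphy of the bilateral series\<close>

lemma holomorphic_P: "P holomorphic_on S"
proof -
  have "P holomorphic_on UNIV"
  proof (rule holomorphic_uniform_sequence)
    show "(\<lambda>z. \<Prod>i<n. 1 - z * q ^ i) holomorphic_on UNIV" for n
      by (intro holomorphic_intros)
    fix z :: complex
    have "uniformly_convergent_on (cball z 1) (\<lambda>n y. \<Prod>i<n. 1 - y * q ^ i)"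
    proof (rule uniformly_convergent_on_prod')
      show "uniformly_convergent_on (cball z 1) (\<lambda>N y. \<Sum>n<N. norm (1 - y * q ^ n - 1))"
      proof (rule Weierstrass_m_test')
        show "norm (norm (1 - y * q ^ n - 1)) \<le> (norm z + 1) * norm q ^ n" if "y \<in> cball z 1" for n y
        proof -
          have "norm y \<le> norm z + 1"
            using that norm_triangle_sub[of y z] by (simp add: dist_norm norm_minus_commute)
          then show ?thesis by (simp add: norm_mult norm_power mult_right_mono)
        qed
        show "summable (\<lambda>n. (norm z + 1) * norm q ^ n)"
          using norm_q by (intro summable_mult summable_geometric) simp
      qed
    qed (auto intro!: continuous_intros)
    then have "uniform_limit (cball z 1) (\<lambda>n y. \<Prod>i<n. 1 - y * q ^ i)
        (\<lambda>y. lim (\<lambda>n. \<Prod>i<n. 1 - y * q ^ i)) sequentially"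
      by (simp add: uniformly_convergent_uniform_limit_iff)
    moreover have "lim (\<lambda>n. \<Prod>i<n. 1 - y * q ^ i) = P y" for y
    proof (rule limI)
      show "(\<lambda>n. \<Prod>i<n. 1 - y * q ^ i) \<longlonglongrightarrow> P y"
        unfolding qpoch_inf_def LIMSEQ_lessThan_iff_atMost
        by (rule convergent_prod_LIMSEQ[OF convergent_prod_qpoch[OF norm_q]])
    qed
    ultimately show "\<exists>d>0. cball z d \<subseteq> UNIV \<and>
        uniform_limit (cball z d) (\<lambda>n z. \<Prod>i<n. 1 - z * q ^ i) P sequentially"
      by (intro exI[of _ 1]) simp
  qed auto
  then show ?thesis
    by (rule holomorphic_on_subset) simp
qed

lemma holomorphic_P_comp [holomorphic_intros]:
  "f holomorphic_on S \<Longrightarrow> (\<lambda>z. P (f z)) holomorphic_on S"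
  using holomorphic_on_compose[OF _ holomorphic_P] by (simp add: o_def)

text \<open>Multiplication by positive powers of \<open>q\<close> stays inside the disc of radius
  \<open>s\<close>, so compactness gives a bound uniform in \<open>j\<close>.\<close>

lemma P_bound:
  obtains K where "K > 0" "\<And>j y. norm y \<le> s \<Longrightarrow> norm (P (q powi (1 + int j) * y)) \<le> K"
proof -
  have "compact (P ` cball 0 s)"
    by (intro compact_continuous_image holomorphic_on_imp_continuous_on holomorphic_P) simp
  then obtain K where K: "K > 0" "\<forall>z\<in>P ` cball 0 s. norm z \<le> K"
    using compact_imp_bounded bounded_pos by metis
  have "norm (P (q powi (1 + int j) * y)) \<le> K" if "norm y \<le> s" for j y
  proof -
    have "norm (q powi (1 + int j) * y) \<le> 1 * norm y"
      unfolding norm_mult norm_power_int using norm_q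
      by (intro mult_right_mono) (auto simp: power_int_def intro: power_le_one)
    then show ?thesis using K(2) that by auto
  qed
  then show thesis using K(1) that by blast
qed

text \<open>Each step from \<open>j\<close> to \<open>j + 1\<close> contributes the factor 1 -
  y/q^j, of size at most (s/|q|^j)(1 + |q|^j/s). The first parts give the growth shown, and the
  second parts have a bounded product.\<close>

lemma P_bound_neg:
  assumes "s > 0"
  obtains K where "K > 0"
    "\<And>j y. norm y \<le> s \<Longrightarrow> norm (P (q powi (1 - int j) * y)) \<le> K * s ^ j / norm q ^ (j choose 2)"
proof -
  obtain K where K: "K > 0" "\<And>j y. norm y \<le> s \<Longrightarrow> norm (P (q powi (1 + int j) * y)) \<le> K"
    using P_bound by blast
  have Q: "0 < norm q" using q_nz by simp
  \<comment> \<open>The geometric bound for the sum of all |q|^i/s; since 1 + t <= exp t, the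
    product of the corrections is at most \<open>exp c\<close>.\<close>
  define c where "c = 1 / (1 - norm q) / s"
  have "norm (P (q powi (1 - int j) * y)) \<le>
      (\<Prod>i<j. 1 + norm q ^ i / s) * K * s ^ j / norm q ^ (j choose 2)" if y: "norm y \<le> s" for j y
  proof (induction j)
    case 0
    then show ?case using K(2)[OF y, of 0] by (simp add: numeral_2_eq_2)
  next
    case (Suc j)
    have "P (q powi (1 - int (Suc j)) * y) = (1 - y / q ^ j) * P (q powi (1 - int j) * y)"
      using P_step[of "q powi (1 - int (Suc j)) * y"] q_nz
      by (simp add: power_int_diff power_int_minus field_simps)
    moreover have "norm (1 - y / q ^ j) \<le> (1 + norm q ^ j / s) * s / norm q ^ j"
    proof -
      have "norm (1 - y / q ^ j) \<le> 1 + norm y / norm q ^ j"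
        using norm_triangle_ineq4[of 1 "y / q ^ j"] by (simp add: norm_divide norm_power)
      also have "\<dots> \<le> 1 + s / norm q ^ j"
        using y Q by (simp add: divide_right_mono)
      also have "\<dots> = (1 + norm q ^ j / s) * s / norm q ^ j"
        using assms Q by (simp add: field_simps)
      finally show ?thesis .
    qed
    ultimately have "norm (P (q powi (1 - int (Suc j)) * y)) \<le> ((1 + norm q ^ j / s) * s / norm q ^ j) *
        ((\<Prod>i<j. 1 + norm q ^ i / s) * K * s ^ j / norm q ^ (j choose 2))"
      using Suc by (simp only: norm_mult) (intro mult_mono order_trans[OF norm_ge_zero], auto)
    also have "\<dots> = (\<Prod>i<Suc j. 1 + norm q ^ i / s) * K * s ^ Suc j / norm q ^ (Suc j choose 2)"
      by (simp add: numeral_2_eq_2 power_add mult_ac)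
    finally show ?case .
  qed
  moreover have "(\<Prod>i<j. 1 + norm q ^ i / s) \<le> exp c" for j
  proof -
    have "(\<Prod>i<j. 1 + norm q ^ i / s) \<le> (\<Prod>i<j. exp (norm q ^ i / s))"
      using assms by (intro prod_mono) (auto intro: add_nonneg_nonneg)
    also have "\<dots> = exp (\<Sum>i<j. norm q ^ i / s)"
      by (simp add: exp_sum)
    also have "(\<Sum>i<j. norm q ^ i / s) \<le> c"
    proof -
      have "(\<Sum>i<j. norm q ^ i) \<le> (\<Sum>i. norm q ^ i)"
        using norm_q by (intro sum_le_suminf summable_geometric) auto
      also have "\<dots> = 1 / (1 - norm q)"
        using norm_q by (intro suminf_geometric) simp
      finally show ?thesis
        unfolding c_def sum_divide_distrib[symmetric] using assms by (intro divide_right_mono) auto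
    qed
    finally show ?thesis by simp
  qed
  moreover have "(\<Prod>i<j. 1 + norm q ^ i / s) * K * s ^ j / norm q ^ (j choose 2) \<le> exp c * K * s ^ j / norm q ^ (j choose 2)"
     if "(\<Prod>i<j. 1 + norm q ^ i / s) \<le> exp c" for j
    using that K(1) assms Q by (intro divide_right_mono mult_right_mono) auto
  ultimately have "norm (P (q powi (1 - int j) * y)) \<le> (exp c * K) * s ^ j / norm q ^ (j choose 2)"
    if "norm y \<le> s" for j y
    using that by (meson order_trans)
  then show thesis
    using K(1) by (intro that[of "exp c * K"]) auto
qed

lemma summable_on_geometric_int:
  fixes \<rho> :: real
  assumes "0 \<le> \<rho>" "\<rho> < 1"
  shows "(\<lambda>k::int. K * \<rho> ^ nat \<bar>k\<bar>) summable_on UNIV"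
proof -
  have geo: "(\<lambda>n. \<rho> ^ n) summable_on UNIV"
    using assms by (intro norm_summable_imp_summable_on) (auto simp: norm_power intro: summable_geometric)
  have "(\<lambda>k::int. \<rho> ^ nat \<bar>k\<bar>) summable_on range int"
    using geo by (subst summable_on_reindex) (auto simp: o_def)
  moreover have "(\<lambda>k::int. \<rho> ^ nat \<bar>k\<bar>) summable_on range (\<lambda>n. - int n)"
    using geo by (subst summable_on_reindex) (auto simp: o_def inj_def)
  ultimately have "(\<lambda>k::int. \<rho> ^ nat \<bar>k\<bar>) summable_on (range int \<union> range (\<lambda>n. - int n))"
    by (rule summable_on_union)
  moreover have "range int \<union> range (\<lambda>n. - int n) = UNIV"
    by (auto simp: image_iff) (metis int_cases2)
  ultimately show ?thesis
    by (intro summable_on_cmult_right) simp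
qed

text \<open>A single estimate, uniform on the closed disc, that yields both absolute summability
  over the integers and holomorphy of the sum.\<close>

definition geom_bounded :: "real \<Rightarrow> real \<Rightarrow> (complex \<Rightarrow> int \<Rightarrow> complex) \<Rightarrow> bool" where
  "geom_bounded r \<rho> f \<longleftrightarrow> (\<exists>K. \<forall>x k. norm x \<le> r \<longrightarrow> norm (f x k) \<le> K * \<rho> ^ nat \<bar>k\<bar>)"

lemma geom_boundedI:
  assumes "\<And>x j. norm x \<le> r \<Longrightarrow> norm (f x (int j)) \<le> K * \<rho>\<^sub>1 ^ j"
    and "\<And>x j. norm x \<le> r \<Longrightarrow> norm (f x (- int j)) \<le> L * \<rho>\<^sub>2 ^ j"
    and "0 \<le> \<rho>\<^sub>1" "0 \<le> \<rho>\<^sub>2" "\<rho>\<^sub>1 \<le> \<rho>" "\<rho>\<^sub>2 \<le> \<rho>"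
  shows "geom_bounded r \<rho> f"
  unfolding geom_bounded_def
proof (intro exI allI impI)
  fix x :: complex and k :: int assume x: "norm x \<le> r"
  define M where "M = max 0 (max K L)"
  have le: "A * \<rho>' ^ j \<le> M * \<rho> ^ j" if "A \<le> M" "0 \<le> \<rho>'" "\<rho>' \<le> \<rho>" for A \<rho>' j
    using that by (intro mult_mono power_mono) (auto simp: M_def)
  have KL: "K \<le> M" "L \<le> M" by (auto simp: M_def)
  show "norm (f x k) \<le> M * \<rho> ^ nat \<bar>k\<bar>"
  proof (cases "k \<ge> 0")
    case True
    then show ?thesis
      using assms(1)[OF x, of "nat k"] le[OF KL(1) assms(3,5), of "nat k"] True by simp
  next
    case False
    then show ?thesis
      using assms(2)[OF x, of "nat (- k)"] le[OF KL(2) assms(4,6), of "nat (- k)"] False by simp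
  qed
qed

lemma geom_bounded_summable:
  assumes "geom_bounded r \<rho> f" "0 \<le> \<rho>" "\<rho> < 1" "norm x \<le> r"
  shows "(\<lambda>k. norm (f x k)) summable_on UNIV"
proof -
  obtain K where "\<forall>x k. norm x \<le> r \<longrightarrow> norm (f x k) \<le> K * \<rho> ^ nat \<bar>k\<bar>"
    using assms(1) by (auto simp: geom_bounded_def)
  then show ?thesis
    using assms by (intro summable_on_comparison_test[OF summable_on_geometric_int[of \<rho> K]]) auto
qed

text \<open>The Weierstrass M-test is applied along the filter of finite index sets, so the
  unordered sum is handled directly as a uniform limit.\<close>

lemma geom_bounded_holomorphic:
  assumes "geom_bounded r \<rho> f" "0 \<le> \<rho>" "\<rho> < 1" "\<And>k. (\<lambda>x. f x k) holomorphic_on UNIV"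
  shows "(\<lambda>x. \<Sum>\<^sub>\<infinity>k. f x k) holomorphic_on ball 0 r"
proof -
  obtain K where K: "\<forall>x k. norm x \<le> r \<longrightarrow> norm (f x k) \<le> K * \<rho> ^ nat \<bar>k\<bar>"
    using assms(1) by (auto simp: geom_bounded_def)
  have "uniform_limit (cball 0 r) (\<lambda>X x. \<Sum>k\<in>X. f x k) (\<lambda>x. \<Sum>\<^sub>\<infinity>k. f x k) (finite_subsets_at_top UNIV)"
    using K by (intro Weierstrass_m_test_general[OF _ summable_on_geometric_int[OF assms(2,3)]]) auto
  then show ?thesis
  proof (rule holomorphic_uniform_limit[rotated])
    have "(\<lambda>x. \<Sum>k\<in>X. f x k) holomorphic_on UNIV" for X
      by (intro holomorphic_intros assms)
    then show "\<forall>\<^sub>F X in finite_subsets_at_top UNIV. continuous_on (cball 0 r) (\<lambda>x. \<Sum>k\<in>X. f x k) \<and>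
        (\<lambda>x. \<Sum>k\<in>X. f x k) holomorphic_on ball 0 r"
      by (intro always_eventually allI conjI holomorphic_on_imp_continuous_on)
         (auto intro: holomorphic_on_subset)
  qed simp_all
qed

text \<open>
  Up to factors independent of the summation index, \<open>lterm\<close> and \<open>rterm\<close> are the terms of the
  \<open>\<^sub>2\<psi>\<^sub>2\<close> and of the \<open>\<^sub>8\<psi>\<^sub>8\<close> series after the substitution \<open>\<alpha> = ax\<close>, \<open>u = 1/(bx)\<close>, \<open>v = 1/(cx)\<close>.
\<close>

definition lterm :: "complex \<Rightarrow> complex \<Rightarrow> complex \<Rightarrow> complex \<Rightarrow> int \<Rightarrow> complex" where
  "lterm al u v x k = al powi k * q powi (k ^ 2) *
     (P (q powi (1 - k) * (x * u)) * P (q powi (1 - k) * (x * v)) *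
      P (q powi (1 + k) * (al * u)) * P (q powi (1 + k) * (al * v)))"

definition rterm :: "complex \<Rightarrow> complex \<Rightarrow> complex \<Rightarrow> complex \<Rightarrow> int \<Rightarrow> complex" where
  "rterm al u v x n = (1 - al * q powi (2 * n)) * al powi (3 * n) * q powi (3 * n ^ 2 - n) *
     (P (q powi (1 - 2 * n) * (x / al)) * P (q powi (1 + 2 * n) * (x * al)) *
      P (q powi (1 - n) * u) * P (q powi (1 - n) * v) *
      P (q powi (1 + n) * (al * u)) * P (q powi (1 + n) * (al * v)))"

text \<open>This and \<open>double_choose\<close> split the quadratic exponents of \<open>q\<close>
  into the triangular ones that occur in \<open>P_bound_neg\<close>.\<close>

lemma square_choose: "j ^ 2 = j + (j choose 2) + (j choose 2)"
  by (induction j) (auto simp: numeral_2_eq_2)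

lemma double_choose: "2 * j choose 2 = j ^ 2 + ((j choose 2) + (j choose 2))"
  by (induction j) (auto simp: numeral_2_eq_2)

lemma norm_mult4_mono:
  "norm a \<le> A \<Longrightarrow> norm b \<le> B \<Longrightarrow> norm c \<le> C \<Longrightarrow> norm d \<le> D \<Longrightarrow>
    norm a * norm b * norm c * norm d \<le> A * B * C * D"
  for a b c d :: complex
  by (intro mult_mono mult_nonneg_nonneg) (auto intro: order_trans[OF norm_ge_zero])

lemma norm_mult6_mono:
  "norm a \<le> A \<Longrightarrow> norm b \<le> B \<Longrightarrow> norm c \<le> C \<Longrightarrow> norm d \<le> D \<Longrightarrow> norm e \<le> E \<Longrightarrow> norm f \<le> F \<Longrightarrow>
    norm a * norm b * norm c * norm d * norm e * norm f \<le> A * B * C * D * E * F"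
  for a b c d e f :: complex
  by (intro mult_mono mult_nonneg_nonneg) (auto intro: order_trans[OF norm_ge_zero])

text \<open>On either side of 0 exactly two of the four products grow, each like |q|^(-(j choose
  2)), and \<open>q^(j^2)\<close> cancels this growth up to |q|^j. The growing pair contains
  \<open>x\<close> only for k > 0; hence the two different ratios in the maximum.\<close>

lemma geom_bounded_lterm:
  assumes "al \<noteq> 0" "u \<noteq> 0" "v \<noteq> 0" "r > 0"
  shows "geom_bounded r (max (norm (al * q * u * v) * r ^ 2) (norm (al * q * u * v))) (lterm al u v)"
proof -
  define Q where "Q = norm q"
  have Q: "Q > 0" using q_nz by (simp add: Q_def)
  have Qi: "norm (q powi k) = Q powi k" for k by (simp add: Q_def norm_power_int)
  obtain K1 where K1: "K1 > 0" "\<And>j y. norm y \<le> r * norm u \<Longrightarrow> norm (P (q powi (1 + int j) * y)) \<le> K1"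
    using P_bound by blast
  obtain K2 where K2: "K2 > 0" "\<And>j y. norm y \<le> r * norm v \<Longrightarrow> norm (P (q powi (1 + int j) * y)) \<le> K2"
    using P_bound by blast
  obtain K3 where K3: "K3 > 0" "\<And>j y. norm y \<le> norm (al * u) \<Longrightarrow> norm (P (q powi (1 + int j) * y)) \<le> K3"
    using P_bound by blast
  obtain K4 where K4: "K4 > 0" "\<And>j y. norm y \<le> norm (al * v) \<Longrightarrow> norm (P (q powi (1 + int j) * y)) \<le> K4"
    using P_bound by blast
  obtain L1 where L1: "L1 > 0" "\<And>j y. norm y \<le> r * norm u \<Longrightarrow>
      norm (P (q powi (1 - int j) * y)) \<le> L1 * (r * norm u) ^ j / norm q ^ (j choose 2)"
    using P_bound_neg[of "r * norm u"] assms by auto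
  obtain L2 where L2: "L2 > 0" "\<And>j y. norm y \<le> r * norm v \<Longrightarrow>
      norm (P (q powi (1 - int j) * y)) \<le> L2 * (r * norm v) ^ j / norm q ^ (j choose 2)"
    using P_bound_neg[of "r * norm v"] assms by auto
  obtain L3 where L3: "L3 > 0" "\<And>j y. norm y \<le> norm (al * u) \<Longrightarrow>
      norm (P (q powi (1 - int j) * y)) \<le> L3 * norm (al * u) ^ j / norm q ^ (j choose 2)"
    using P_bound_neg[of "norm (al * u)"] assms by auto
  obtain L4 where L4: "L4 > 0" "\<And>j y. norm y \<le> norm (al * v) \<Longrightarrow>
      norm (P (q powi (1 - int j) * y)) \<le> L4 * norm (al * v) ^ j / norm q ^ (j choose 2)"
    using P_bound_neg[of "norm (al * v)"] assms by auto
  show ?thesis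
  proof (rule geom_boundedI[where K = "L1 * L2 * K3 * K4" and L = "K1 * K2 * L3 * L4"])
    fix x :: complex and j :: nat
    assume "norm x \<le> r"
    then have x: "norm (x * u) \<le> r * norm u" "norm (x * v) \<le> r * norm v"
      by (auto simp: norm_mult intro: mult_right_mono)
    have "norm (lterm al u v x (int j)) = norm al ^ j * Q ^ (j ^ 2) *
       (norm (P (q powi (1 - int j) * (x * u))) * norm (P (q powi (1 - int j) * (x * v))) *
        norm (P (q powi (1 + int j) * (al * u))) * norm (P (q powi (1 + int j) * (al * v))))"
      unfolding lterm_def norm_mult norm_power_int Q_def by (simp only: power_int_of_nat flip: of_nat_power)
    also have "\<dots> \<le> norm al ^ j * Q ^ (j ^ 2) *
       ((L1 * (r * norm u) ^ j / Q ^ (j choose 2)) * (L2 * (r * norm v) ^ j / Q ^ (j choose 2)) * K3 * K4)"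
      unfolding Q_def using L1(2)[OF x(1)] L2(2)[OF x(2)] K3(2)[OF order_refl] K4(2)[OF order_refl]
      by (intro mult_left_mono norm_mult4_mono) auto
    also have "\<dots> = L1 * L2 * K3 * K4 * (norm (al * q * u * v) * r ^ 2) ^ j"
      unfolding square_choose[of j] power_add using Q
      by (simp add: norm_mult power_mult_distrib power2_eq_square flip: Q_def)
    finally show "norm (lterm al u v x (int j)) \<le> L1 * L2 * K3 * K4 * (norm (al * q * u * v) * r ^ 2) ^ j" .
    have minus: "1 - - int j = 1 + int j" "1 + - int j = 1 - int j" "(- int j) ^ 2 = int (j ^ 2)"
      by auto
    have "norm (lterm al u v x (- int j)) = inverse (norm al ^ j) * Q ^ (j ^ 2) *
       (norm (P (q powi (1 + int j) * (x * u))) * norm (P (q powi (1 + int j) * (x * v))) *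
        norm (P (q powi (1 - int j) * (al * u))) * norm (P (q powi (1 - int j) * (al * v))))"
      unfolding lterm_def norm_mult norm_power_int Q_def minus by (simp only: power_int_of_nat power_int_minus)
    also have "\<dots> \<le> inverse (norm al ^ j) * Q ^ (j ^ 2) *
       (K1 * K2 * (L3 * norm (al * u) ^ j / Q ^ (j choose 2)) * (L4 * norm (al * v) ^ j / Q ^ (j choose 2)))"
      unfolding Q_def using K1(2)[OF x(1)] K2(2)[OF x(2)] L3(2)[OF order_refl] L4(2)[OF order_refl]
      by (intro mult_left_mono norm_mult4_mono) auto
    also have "\<dots> = K1 * K2 * L3 * L4 * norm (al * q * u * v) ^ j"
      unfolding square_choose[of j] power_add using Q assms(1)
      by (simp add: norm_mult power_mult_distrib power2_eq_square flip: Q_def)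
    finally show "norm (lterm al u v x (- int j)) \<le> K1 * K2 * L3 * L4 * norm (al * q * u * v) ^ j" .
  qed auto
qed

text \<open>The cancellation is that of \<open>geom_bounded_lterm\<close>, now with one product of
  doubled index and two ordinary ones growing. The growing product of doubled index contains
  \<open>x\<close> on both sides of 0, so both sides have the same ratio.\<close>

lemma geom_bounded_rterm:
  assumes "al \<noteq> 0" "u \<noteq> 0" "v \<noteq> 0" "r > 0"
  shows "geom_bounded r (norm (al * q * u * v) * r ^ 2) (rterm al u v)"
proof -
  define Q where "Q = norm q"
  have Q: "Q > 0" "Q \<le> 1" using q_nz norm_q by (simp_all add: Q_def)
  obtain K1 where K1: "K1 > 0" "\<And>j y. norm y \<le> r / norm al \<Longrightarrow> norm (P (q powi (1 + int j) * y)) \<le> K1"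
    using P_bound by blast
  obtain K2 where K2: "K2 > 0" "\<And>j y. norm y \<le> r * norm al \<Longrightarrow> norm (P (q powi (1 + int j) * y)) \<le> K2"
    using P_bound by blast
  obtain K3 where K3: "K3 > 0" "\<And>j y. norm y \<le> norm u \<Longrightarrow> norm (P (q powi (1 + int j) * y)) \<le> K3"
    using P_bound by blast
  obtain K4 where K4: "K4 > 0" "\<And>j y. norm y \<le> norm v \<Longrightarrow> norm (P (q powi (1 + int j) * y)) \<le> K4"
    using P_bound by blast
  obtain K5 where K5: "K5 > 0" "\<And>j y. norm y \<le> norm (al * u) \<Longrightarrow> norm (P (q powi (1 + int j) * y)) \<le> K5"
    using P_bound by blast
  obtain K6 where K6: "K6 > 0" "\<And>j y. norm y \<le> norm (al * v) \<Longrightarrow> norm (P (q powi (1 + int j) * y)) \<le> K6"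
    using P_bound by blast
  obtain L1 where L1: "L1 > 0" "\<And>j y. norm y \<le> r / norm al \<Longrightarrow>
      norm (P (q powi (1 - int j) * y)) \<le> L1 * (r / norm al) ^ j / norm q ^ (j choose 2)"
    using P_bound_neg[of "r / norm al"] assms by auto
  obtain L2 where L2: "L2 > 0" "\<And>j y. norm y \<le> r * norm al \<Longrightarrow>
      norm (P (q powi (1 - int j) * y)) \<le> L2 * (r * norm al) ^ j / norm q ^ (j choose 2)"
    using P_bound_neg[of "r * norm al"] assms by auto
  obtain L3 where L3: "L3 > 0" "\<And>j y. norm y \<le> norm u \<Longrightarrow>
      norm (P (q powi (1 - int j) * y)) \<le> L3 * norm u ^ j / norm q ^ (j choose 2)"
    using P_bound_neg[of "norm u"] assms by auto
  obtain L4 where L4: "L4 > 0" "\<And>j y. norm y \<le> norm v \<Longrightarrow>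
      norm (P (q powi (1 - int j) * y)) \<le> L4 * norm v ^ j / norm q ^ (j choose 2)"
    using P_bound_neg[of "norm v"] assms by auto
  obtain L5 where L5: "L5 > 0" "\<And>j y. norm y \<le> norm (al * u) \<Longrightarrow>
      norm (P (q powi (1 - int j) * y)) \<le> L5 * norm (al * u) ^ j / norm q ^ (j choose 2)"
    using P_bound_neg[of "norm (al * u)"] assms by auto
  obtain L6 where L6: "L6 > 0" "\<And>j y. norm y \<le> norm (al * v) \<Longrightarrow>
      norm (P (q powi (1 - int j) * y)) \<le> L6 * norm (al * v) ^ j / norm q ^ (j choose 2)"
    using P_bound_neg[of "norm (al * v)"] assms by auto
  show ?thesis
  proof (rule geom_boundedI[where K = "(1 + norm al) * (L1 * K2 * L3 * L4 * K5 * K6)"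
        and L = "(1 + norm al) * (K1 * L2 * K3 * K4 * L5 * L6)"])
    fix x :: complex and j :: nat
    assume "norm x \<le> r"
    then have x: "norm (x / al) \<le> r / norm al" "norm (x * al) \<le> r * norm al"
      by (auto simp: norm_mult norm_divide intro: mult_right_mono divide_right_mono)
    define T where "T = Q ^ (2 * j choose 2)"
    define C where "C = Q ^ (j choose 2)"
    have TC: "T > 0" "C > 0" using Q by (simp_all add: T_def C_def)
    have dbl: "1 - 2 * int j = 1 - int (2 * j)" "1 + 2 * int j = 1 + int (2 * j)"
      "3 * int j = int (3 * j)" "2 * int j = int (2 * j)" by auto
    have expo: "3 * int j ^ 2 - int j = int (j + (2 * j choose 2) + (j choose 2) + (j choose 2))"
      "3 * int j ^ 2 + int j = int (3 * j + (2 * j choose 2) + (j choose 2) + (j choose 2))"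
      using square_choose[of j] double_choose[of j] by (simp_all flip: of_nat_power)
    have q2: "norm (1 - al * q powi (2 * int j)) \<le> 1 + norm al"
    proof -
      have "norm (1 - al * q powi (2 * int j)) \<le> 1 + norm al * Q ^ (2 * j)"
        using norm_triangle_ineq4[of 1 "al * q powi (2 * int j)"] unfolding dbl power_int_of_nat
        by (simp add: norm_mult norm_power Q_def)
      also have "\<dots> \<le> 1 + norm al * 1"
        using Q by (intro add_left_mono mult_left_mono power_le_one) auto
      finally show ?thesis by simp
    qed
    have "norm (rterm al u v x (int j)) = norm (1 - al * q powi (2 * int j)) * norm al ^ (3 * j) *
       (Q ^ j * T * C * C) *
       (norm (P (q powi (1 - int (2 * j)) * (x / al))) * norm (P (q powi (1 + int (2 * j)) * (x * al))) *
        norm (P (q powi (1 - int j) * u)) * norm (P (q powi (1 - int j) * v)) *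
        norm (P (q powi (1 + int j) * (al * u))) * norm (P (q powi (1 + int j) * (al * v))))"
      unfolding rterm_def norm_mult norm_power_int Q_def T_def C_def expo
      by (simp only: power_int_of_nat power_add dbl)
    also have "\<dots> \<le> (1 + norm al) * norm al ^ (3 * j) * (Q ^ j * T * C * C) *
       ((L1 * (r / norm al) ^ (2 * j) / T) * K2 * (L3 * norm u ^ j / C) * (L4 * norm v ^ j / C) * K5 * K6)"
      unfolding T_def C_def Q_def
      using L1(2)[OF x(1), of "2 * j"] K2(2)[OF x(2), of "2 * j"] L3(2)[OF order_refl] L4(2)[OF order_refl]
        K5(2)[OF order_refl] K6(2)[OF order_refl]
      by (intro mult_mono[OF mult_right_mono[OF mult_right_mono[OF q2]]] norm_mult6_mono) auto
    also have "\<dots> = (1 + norm al) * (L1 * K2 * L3 * L4 * K5 * K6) * (norm (al * q * u * v) * r ^ 2) ^ j"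
    proof -
      have a3: "norm al ^ (3 * j) = norm al ^ j * (norm al ^ j * norm al ^ j)"
        by (simp add: power_add numeral_3_eq_3)
      show ?thesis
        unfolding mult_2 a3 power_add using TC assms(1)
        by (simp add: norm_mult power_mult_distrib power_divide power2_eq_square flip: Q_def)
    qed
    finally show "norm (rterm al u v x (int j)) \<le>
        (1 + norm al) * (L1 * K2 * L3 * L4 * K5 * K6) * (norm (al * q * u * v) * r ^ 2) ^ j" .
    \<comment> \<open>For negative indices this factor itself grows like |q|^(-2j). The exponent
      \<open>3 * j\<close> in the second part of \<open>expo\<close> pays for it and leaves
      |q|^j.\<close>
    have q2': "norm (1 - al * q powi (- int (2 * j))) \<le> (1 + norm al) * inverse (Q ^ (2 * j))"
    proof -
      have "norm (1 - al * q powi (- int (2 * j))) \<le> 1 + norm al * inverse (Q ^ (2 * j))"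
        using norm_triangle_ineq4[of 1 "al * q powi (- int (2 * j))"] unfolding power_int_minus power_int_of_nat
        by (simp add: norm_mult norm_power norm_inverse Q_def)
      moreover have "1 \<le> inverse (Q ^ (2 * j))"
        using Q by (intro one_le_inverse power_le_one) auto
      ultimately show ?thesis by (simp add: algebra_simps)
    qed
    have minus: "1 - - int j = 1 + int j" "1 + - int j = 1 - int j" "(- int j) ^ 2 = int j ^ 2"
      "2 * - int j = - int (2 * j)" "3 * - int j = - int (3 * j)"
      "1 - - int (2 * j) = 1 + int (2 * j)" "1 + - int (2 * j) = 1 - int (2 * j)"
      "3 * int j ^ 2 - - int j = 3 * int j ^ 2 + int j"
      by auto
    have "norm (rterm al u v x (- int j)) = norm (1 - al * q powi (- int (2 * j))) * inverse (norm al ^ (3 * j)) *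
       (Q ^ (3 * j) * T * C * C) *
       (norm (P (q powi (1 + int (2 * j)) * (x / al))) * norm (P (q powi (1 - int (2 * j)) * (x * al))) *
        norm (P (q powi (1 + int j) * u)) * norm (P (q powi (1 + int j) * v)) *
        norm (P (q powi (1 - int j) * (al * u))) * norm (P (q powi (1 - int j) * (al * v))))"
      unfolding rterm_def norm_mult norm_power_int Q_def T_def C_def minus expo
      by (simp only: power_int_of_nat power_int_minus power_add)
    also have "\<dots> \<le> (1 + norm al) * inverse (Q ^ (2 * j)) * inverse (norm al ^ (3 * j)) * (Q ^ (3 * j) * T * C * C) *
       (K1 * (L2 * (r * norm al) ^ (2 * j) / T) * K3 * K4 *
         (L5 * norm (al * u) ^ j / C) * (L6 * norm (al * v) ^ j / C))"
      unfolding T_def C_def Q_def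
      using K1(2)[OF x(1), of "2 * j"] L2(2)[OF x(2), of "2 * j"] K3(2)[OF order_refl] K4(2)[OF order_refl]
        L5(2)[OF order_refl] L6(2)[OF order_refl]
      by (intro mult_mono[OF mult_right_mono[OF mult_right_mono[OF q2'[unfolded Q_def]]]] norm_mult6_mono) auto
    also have "\<dots> = (1 + norm al) * (K1 * L2 * K3 * K4 * L5 * L6) * (norm (al * q * u * v) * r ^ 2) ^ j"
    proof -
      have a3: "z ^ (3 * j) = z ^ j * (z ^ j * z ^ j)" for z :: real
        by (simp add: power_add numeral_3_eq_3)
      show ?thesis
        unfolding mult_2 a3 power_add using TC assms(1) Q
        by (simp add: norm_mult power_mult_distrib power_divide power2_eq_square flip: Q_def)
          (simp add: field_simps)
    qed
    finally show "norm (rterm al u v x (- int j)) \<le>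
        (1 + norm al) * (K1 * L2 * K3 * K4 * L5 * L6) * (norm (al * q * u * v) * r ^ 2) ^ j" .
  qed auto
qed

subsection \<open>The denominator-free identity\<close>

lemma lterm_power: "lterm al u v (q ^ N) k = al powi k * q powi (k ^ 2) * quad al u v N k"
proof -
  have "q powi (1 - k + int N) = q powi (1 - k) * q ^ N"
    using q_nz by (simp add: power_int_add)
  then show ?thesis
    unfolding lterm_def quad_def by (simp add: mult_ac)
qed

text \<open>The values are finite for every \<open>m\<close>, tend to 1 as m goes to infinity and to
  0 as m goes to minus infinity.\<close>

lemma inverse_bounded:
  assumes "z \<noteq> 0" "\<And>m::int. z * q powi m \<noteq> 1"
  obtains K where "K > 0" "\<And>m::int. norm (inverse (1 - z * q powi m)) \<le> K"
proof -
  have q0: "(\<lambda>n. q ^ n) \<longlonglongrightarrow> 0"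
    using norm_q by (rule LIMSEQ_power_zero)
  have "(\<lambda>n. inverse (1 - z * q ^ n)) \<longlonglongrightarrow> inverse (1 - z * 0)"
    by (intro tendsto_intros q0) simp
  then have "Bseq (\<lambda>n. inverse (1 - z * q ^ n))"
    by (intro convergent_imp_Bseq convergentI)
  then obtain K1 where K1: "K1 > 0" "\<And>n. norm (inverse (1 - z * q ^ n)) \<le> K1"
    by (auto elim: BseqE)
  have "(\<lambda>n. q ^ n / (q ^ n - z)) \<longlonglongrightarrow> 0 / (0 - z)"
    using assms(1) by (intro tendsto_intros q0) simp
  then have "Bseq (\<lambda>n. q ^ n / (q ^ n - z))"
    by (intro convergent_imp_Bseq convergentI)
  then obtain K2 where K2: "\<And>n. norm (q ^ n / (q ^ n - z)) \<le> K2"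
    by (elim BseqE) blast
  have "inverse (1 - z * q powi (- int n)) = q ^ n / (q ^ n - z)" for n
    using q_nz by (simp add: power_int_minus divide_simps)
  then have "norm (inverse (1 - z * q powi m)) \<le> max K1 K2" for m
    using K1(2)[of "nat m"] K2[of "nat (- m)"]
    by (cases m rule: int_cases2) (auto simp: le_max_iff_disj)
  then show thesis
    using K1(1) by (intro that[of "max K1 K2"]) auto
qed

definition shift_coeff :: "complex \<Rightarrow> nat \<Rightarrow> nat \<Rightarrow> int \<Rightarrow> complex" where
  "shift_coeff al N j n = (let B = q powi (- 2 * n) / al in
     qbin N j * (- 1) ^ j * q ^ (j choose 2) * (1 - B) / qpoch_fin (B * q powi (- int j)) (Suc N))"

text \<open>The exponent j^2 in \<open>conn_coeff\<close> completes the square: k^2 - 2kj + j^2 =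
  n^2. Thus, after the shift, all \<open>j\<close> share the same series term, that of
  \<open>x = 1\<close>, and \<open>j\<close> remains only in the coefficient, whose base is B = A
  q^(2j).\<close>

lemma shifted_summand:
  fixes n :: int and j :: nat
  assumes "al \<noteq> 0"
  defines "k \<equiv> n + int j"
  shows "al powi k * q powi (k ^ 2) *
      (conn_coeff N j (q powi (- 2 * k) / al) * quad al u v 0 (k - int j)) =
    shift_coeff al N j n * lterm al u v 1 n"
proof -
  define B where "B = q powi (- 2 * n) / al"
  define A where "A = q powi (- 2 * k) / al"
  have AB: "A = B * q powi (- 2 * int j)"
    unfolding A_def B_def k_def using q_nz by (simp add: power_int_add power_int_diff power_int_minus distrib_left field_simps)
  have e1: "A * q ^ (2 * j) = B" "A * q ^ j = B * q powi (- int j)"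
    unfolding AB using q_nz by (simp_all add: power_int_minus field_simps power_int_mult power_mult)
       (metis mult.commute power_add power_mult mult_2)
  have "al powi k * q powi (k ^ 2) * ((- A) ^ j * q ^ (j ^ 2)) =
     (- 1) ^ j * (al powi k / al ^ j) * (q powi (k ^ 2) * q powi (- 2 * k * int j) * q powi int (j ^ 2))"
  proof -
    have "(- A) ^ j = (- 1) ^ j * A ^ j"
      by (rule power_minus)
    moreover have "A ^ j = q powi (- 2 * k * int j) / al ^ j"
      unfolding A_def power_divide power_int_power' ..
    ultimately show ?thesis by (simp only: power_int_of_nat) (simp add: mult_ac)
  qed
  also have "al powi k / al ^ j = al powi n"
    using assms by (simp add: power_int_add)
  also have "q powi (k ^ 2) * q powi (- 2 * k * int j) * q powi int (j ^ 2) =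
      q powi (k ^ 2 + - 2 * k * int j + int (j ^ 2))"
    by (simp only: power_int_add[OF disjI1[OF q_nz]])
  also have "k ^ 2 + - 2 * k * int j + int (j ^ 2) = n ^ 2"
    by (simp add: k_def power2_eq_square algebra_simps)
  finally have main: "al powi k * q powi (k ^ 2) * ((- A) ^ j * q ^ (j ^ 2)) = (- 1) ^ j * al powi n * q powi (n ^ 2)" .
  have l: "lterm al u v 1 n = al powi n * q powi (n ^ 2) * quad al u v 0 n"
    using lterm_power[of al u v 0 n] by simp
  have kn: "k - int j = n" by (simp add: k_def)
  have "al powi k * q powi (k ^ 2) * (conn_coeff N j A * quad al u v 0 (k - int j)) =
     (al powi k * q powi (k ^ 2) * ((- A) ^ j * q ^ (j ^ 2))) * qbin N j * q ^ (j choose 2) *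
     (1 - B) / qpoch_fin (B * q powi (- int j)) (Suc N) * quad al u v 0 n"
    unfolding conn_coeff_def e1 kn power_add by (simp add: mult_ac)
  also have "\<dots> = shift_coeff al N j n * lterm al u v 1 n"
    unfolding main l shift_coeff_def Let_def B_def[symmetric] by (simp add: mult_ac)
  finally show ?thesis unfolding A_def .
qed

text \<open>The numerator \<open>1 - B\<close> cancels the factor with \<open>i = j\<close> of the
  denominator; the reciprocals of the other factors are bounded by \<open>inverse_bounded\<close>.
  Together with absolute convergence at \<open>x = 1\<close>, this makes the series for each single
  \<open>j\<close> converge.\<close>

lemma shift_coeff_bounded:
  assumes "al \<noteq> 0" and al: "\<And>m::int. al * q powi m \<noteq> 1" and "j \<le> N"
  obtains K where "\<And>n. norm (shift_coeff al N j n) \<le> K"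
proof -
  have "inverse al * q powi m \<noteq> 1" for m :: int
    using al[of "- m"] assms(1) q_nz by (auto simp: power_int_minus field_simps)
  then obtain K where K: "K > 0" "\<And>m::int. norm (inverse (1 - inverse al * q powi m)) \<le> K"
    using inverse_bounded[of "inverse al"] assms(1) by auto
  have "norm (shift_coeff al N j n) \<le> norm (qbin N j * q ^ (j choose 2)) * (\<Prod>i\<in>{..N}-{j}. K)" for n
  proof -
    define B where "B = q powi (- 2 * n) / al"
    let ?t = "\<lambda>i. 1 - inverse al * q powi (- 2 * n - int j + int i)"
    have t: "1 - B * q powi (- int j) * q ^ i = ?t i" for i
      using q_nz by (simp add: B_def power_int_add power_int_diff power_int_minus field_simps)
    have "qpoch_fin (B * q powi (- int j)) (Suc N) = (\<Prod>i\<le>N. ?t i)"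
      unfolding qpoch_fin_def t lessThan_Suc_atMost ..
    also have "\<dots> = ?t j * (\<Prod>i\<in>{..N}-{j}. ?t i)"
      using assms(3) by (intro prod.remove) auto
    also have "?t j = 1 - B"
      by (simp add: B_def field_simps)
    finally have "shift_coeff al N j n = qbin N j * (- 1) ^ j * q ^ (j choose 2) * ((1 - B) / ((1 - B) * (\<Prod>i\<in>{..N}-{j}. ?t i)))"
      unfolding shift_coeff_def Let_def B_def[symmetric] by simp
    moreover have "1 - B \<noteq> 0"
      using al[of "2 * n"] assms(1) q_nz by (auto simp: B_def power_int_minus field_simps)
    moreover have "inverse (\<Prod>i\<in>{..N}-{j}. ?t i) = (\<Prod>i\<in>{..N}-{j}. inverse (?t i))"
      by (simp add: prod_inversef[symmetric] o_def)
    ultimately have "shift_coeff al N j n = qbin N j * (- 1) ^ j * q ^ (j choose 2) * (\<Prod>i\<in>{..N}-{j}. inverse (?t i))"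
      by (simp only: nonzero_divide_mult_cancel_left) (simp add: inverse_eq_divide)
    then have "norm (shift_coeff al N j n) = norm (qbin N j * q ^ (j choose 2)) * (\<Prod>i\<in>{..N}-{j}. norm (inverse (?t i)))"
      by (simp add: norm_mult norm_power prod_norm)
    also have "\<dots> \<le> norm (qbin N j * q ^ (j choose 2)) * (\<Prod>i\<in>{..N}-{j}. K)"
      by (intro mult_left_mono prod_mono) (use K(2) in auto)
    finally show ?thesis .
  qed
  then show thesis by (rule that)
qed

lemma has_sum_finite_sum:
  fixes f :: "'a \<Rightarrow> 'b \<Rightarrow> 'c :: topological_comm_monoid_add"
  assumes "finite J" "\<And>j. j \<in> J \<Longrightarrow> (f j has_sum S j) A"
  shows "((\<lambda>x. \<Sum>j\<in>J. f j x) has_sum (\<Sum>j\<in>J. S j)) A"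
  using assms by (induction J rule: finite_induct) (auto intro: has_sum_add)

text \<open>At \<open>x = q^N\<close> the finite products and the factor
  \<open>1 - al * q^(2n)\<close> complete the two products of doubled index to P(al q^(2n))
  P(q^(1-2n)/al). By quasi-periodicity this is P(al) P(q/al) up to a power; the shift 2n is even, so
  no sign appears.\<close>

lemma lterm_rterm:
  assumes "al \<noteq> 0"
  defines "B n \<equiv> q powi (- 2 * n) / al"
  shows "rterm al u v (q ^ N) n * (qpoch_fin (q / B n) N * qpoch_fin (q * B n) N) = P al * P (q / al) * lterm al u v 1 n"
proof -
  have B: "B n \<noteq> 0" using assms q_nz by (simp add: B_def)
  have invB: "q / B n = al * q powi (2 * n) * q"
    using q_nz by (simp add: B_def power_int_minus field_simps)
  have e1: "q powi (1 - 2 * n) = q * q powi (- 2 * n)" "q powi (1 + 2 * n) = q * q powi (2 * n)"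
    using q_nz by (simp_all add: power_int_add power_int_diff power_int_minus field_simps)
  have p1: "qpoch_fin (q * B n) N * P (q powi (1 - 2 * n) * (q ^ N / al)) = P (q * B n)"
    using P_split[of "q * B n" N] unfolding e1 B_def by (simp add: mult_ac)
  have p2: "qpoch_fin (q / B n) N * P (q powi (1 + 2 * n) * (q ^ N * al)) = P (al * q powi (2 * n) * q)"
    using P_split[of "al * q powi (2 * n) * q" N] unfolding e1 invB by (simp add: mult_ac)
  have p3: "(1 - al * q powi (2 * n)) * P (al * q powi (2 * n) * q) = P (al * q powi (2 * n))"
    using P_step[of "al * q powi (2 * n)"] by simp
  have even: "(- al) powi (2 * n) = al powi (2 * n)"
    by (simp add: power_int_mult)
  have th: "P al * P (q / al) = al powi (2 * n) * q powi (n * (2 * n - 1)) * (P (al * q powi (2 * n)) * P (q * B n))"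
    using theta_shift[OF assms(1), of "2 * n"] unfolding tri_double even e1 B_def by simp
  have ex: "al powi (3 * n) = al powi n * al powi (2 * n)" "q powi (3 * n ^ 2 - n) = q powi (n ^ 2) * q powi (n * (2 * n - 1))"
    using assms(1) q_nz by (simp_all flip: power_int_add) (simp_all add: power2_eq_square algebra_simps)
  let ?Z = "P (q powi (1 - n) * u) * P (q powi (1 - n) * v) * P (q powi (1 + n) * (al * u)) * P (q powi (1 + n) * (al * v))"
  have "rterm al u v (q ^ N) n * (qpoch_fin (q / B n) N * qpoch_fin (q * B n) N) =
     ((1 - al * q powi (2 * n)) * (qpoch_fin (q / B n) N * P (q powi (1 + 2 * n) * (q ^ N * al)))) *
     (qpoch_fin (q * B n) N * P (q powi (1 - 2 * n) * (q ^ N / al))) *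
     al powi (3 * n) * q powi (3 * n ^ 2 - n) * ?Z"
    unfolding rterm_def by (simp only: mult_ac)
  also have "\<dots> = (P al * P (q / al)) * (al powi n * q powi (n ^ 2) * ?Z)"
    unfolding p1 p2 p3 th ex by (simp only: mult_ac)
  finally show ?thesis
    unfolding lterm_def by simp
qed

lemma identity_at_power:
  assumes "al \<noteq> 0" "u \<noteq> 0" "v \<noteq> 0" and al: "\<And>m::int. al * q powi m \<noteq> 1"
    and conv: "norm (al * q * u * v) < 1"
  shows "P (al * q * u * v) * P al * P (q / al) * P (q * (q ^ N) ^ 2) * (\<Sum>\<^sub>\<infinity>k. lterm al u v (q ^ N) k) =
    P (al * q * u * v * q ^ N) * P (q * q ^ N) * (\<Sum>\<^sub>\<infinity>n. rterm al u v (q ^ N) n)"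
proof -
  define B where "B n = q powi (- 2 * n) / al" for n :: int
  have B: "B n \<noteq> 0" "B n * q powi m \<noteq> 1" for n m
  proof -
    show "B n \<noteq> 0" using assms q_nz by (simp add: B_def)
    show "B n * q powi m \<noteq> 1"
      using al[of "2 * n - m"] assms(1) q_nz by (auto simp: B_def power_int_minus power_int_diff field_simps)
  qed
  have nz: "qpoch_fin (q / B n) N * qpoch_fin (q * B n) N \<noteq> 0" for n
  proof -
    have "q / B n * q ^ i \<noteq> 1" for i
      using B(2)[of n "- int (Suc i)"] B(1)[of n] q_nz unfolding power_int_minus power_int_of_nat
      by (simp add: field_simps)
    moreover have "q * B n * q ^ i \<noteq> 1" for i
      using B(2)[of n "int (Suc i)"] unfolding power_int_of_nat by (simp add: mult_ac)
    ultimately show ?thesis using qpoch_fin_nonzero by simp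
  qed
  have gb: "(\<lambda>k. norm (lterm al u v 1 k)) summable_on UNIV"
    using geom_bounded_lterm[OF assms(1-3), of 1] conv
    by (intro geom_bounded_summable[of 1 "norm (al * q * u * v)"]) auto
  \<comment> \<open>\<open>?g j\<close> is the j-th piece of the expanded left-hand term, and
    \<open>?h j\<close> is the same family indexed by n = k - j. For each fixed \<open>j\<close>
    their bilateral sums agree, which exchanges the two summations.\<close>
  let ?g = "\<lambda>j k. al powi k * q powi (k ^ 2) * (conn_coeff N j (q powi (- 2 * k) / al) * quad al u v 0 (k - int j))"
  let ?h = "\<lambda>j n. shift_coeff al N j n * lterm al u v 1 n"
  have "?h j summable_on UNIV" if jN: "j \<le> N" for j
  proof -
    obtain K where K: "\<And>n. norm (shift_coeff al N j n) \<le> K"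
      using shift_coeff_bounded[OF assms(1) al jN] by blast
    have "(\<lambda>n. K * norm (lterm al u v 1 n)) summable_on UNIV"
      using gb by (rule summable_on_cmult_right)
    then have "(\<lambda>n. norm (?h j n)) summable_on UNIV"
      by (rule Infinite_Sum.abs_summable_on_comparison_test') (simp add: norm_mult mult_right_mono K)
    then show ?thesis by (rule Infinite_Sum.abs_summable_summable)
  qed
  then have h: "(?h j has_sum infsum (?h j) UNIV) UNIV" if "j \<le> N" for j
    using that by (simp add: has_sum_infsum)
  have g: "(?g j has_sum infsum (?h j) UNIV) UNIV" if "j \<le> N" for j
  proof -
    have "(?h j has_sum infsum (?h j) UNIV) UNIV = (?g j has_sum infsum (?h j) UNIV) UNIV"
      by (rule has_sum_reindex_bij_witness[of _ "\<lambda>k. k - int j" "\<lambda>n. n + int j"])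
         (use shifted_summand[OF assms(1)] in auto)
    then show ?thesis using h[OF that] by simp
  qed
  have "((\<lambda>k. \<Sum>j\<le>N. ?g j k) has_sum (\<Sum>j\<le>N. infsum (?h j) UNIV)) UNIV"
    using g by (intro has_sum_finite_sum) auto
  also have "(\<lambda>k. \<Sum>j\<le>N. ?g j k) = (\<lambda>k. qpoch_fin (al * q * u * v) N * lterm al u v (q ^ N) k)"
    unfolding sum_distrib_left[symmetric] quad_connection[OF assms(1) al, symmetric] lterm_power
    by (simp add: mult_ac)
  finally have "((\<lambda>k. qpoch_fin (al * q * u * v) N * lterm al u v (q ^ N) k) has_sum (\<Sum>j\<le>N. infsum (?h j) UNIV)) UNIV" .
  from infsumI[OF this] have 1: "(\<Sum>j\<le>N. infsum (?h j) UNIV) = qpoch_fin (al * q * u * v) N * (\<Sum>\<^sub>\<infinity>k. lterm al u v (q ^ N) k)"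
    by (simp only: infsum_cmult_right')
  have "((\<lambda>n. \<Sum>j\<le>N. ?h j n) has_sum (\<Sum>j\<le>N. infsum (?h j) UNIV)) UNIV"
    using h by (intro has_sum_finite_sum) auto
  from infsumI[OF this] have "(\<Sum>\<^sub>\<infinity>n. P al * P (q / al) * (\<Sum>j\<le>N. ?h j n)) = P al * P (q / al) * (\<Sum>j\<le>N. infsum (?h j) UNIV)"
    by (simp only: infsum_cmult_right')
  moreover have "P al * P (q / al) * (\<Sum>j\<le>N. ?h j n) = qpoch_fin (q ^ Suc N) N * rterm al u v (q ^ N) n" for n
  proof -
    have "(\<Sum>j\<le>N. ?h j n) = qpoch_fin (q ^ Suc N) N / (qpoch_fin (q / B n) N * qpoch_fin (q * B n) N) * lterm al u v 1 n"
      unfolding sum_distrib_right[symmetric] shift_coeff_def Let_def B_def[symmetric]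
      using partial_fraction_sum[of "B n" N] B by simp
    then have "P al * P (q / al) * (\<Sum>j\<le>N. ?h j n) =
        qpoch_fin (q ^ Suc N) N / (qpoch_fin (q / B n) N * qpoch_fin (q * B n) N) * (P al * P (q / al) * lterm al u v 1 n)"
      by simp
    also have "\<dots> = qpoch_fin (q ^ Suc N) N * rterm al u v (q ^ N) n"
      unfolding lterm_rterm[OF assms(1), of u v N n, folded B_def, symmetric] using nz[of n] by simp
    finally show ?thesis .
  qed
  ultimately have 2: "P al * P (q / al) * (\<Sum>j\<le>N. infsum (?h j) UNIV) = qpoch_fin (q ^ Suc N) N * (\<Sum>\<^sub>\<infinity>n. rterm al u v (q ^ N) n)"
    by (simp only: infsum_cmult_right')
  \<comment> \<open>These two splittings absorb the finite products depending on \<open>N\<close>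
    into infinite products whose arguments are polynomial in \<open>x = q^N\<close>.\<close>
  have s1: "P (al * q * u * v) = qpoch_fin (al * q * u * v) N * P (al * q * u * v * q ^ N)"
    by (rule P_split)
  have s2: "P (q * q ^ N) = qpoch_fin (q ^ Suc N) N * P (q * (q ^ N) ^ 2)"
    using P_split[of "q * q ^ N" N] by (simp add: power2_eq_square mult_ac)
  have "P (al * q * u * v) * P al * P (q / al) * P (q * (q ^ N) ^ 2) * (\<Sum>\<^sub>\<infinity>k. lterm al u v (q ^ N) k) =
     P (al * q * u * v * q ^ N) * P (q * (q ^ N) ^ 2) *
     (P al * P (q / al) * (qpoch_fin (al * q * u * v) N * (\<Sum>\<^sub>\<infinity>k. lterm al u v (q ^ N) k)))"
    unfolding s1 by (simp only: mult_ac)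
  also have "\<dots> = P (al * q * u * v * q ^ N) * (qpoch_fin (q ^ Suc N) N * P (q * (q ^ N) ^ 2)) * (\<Sum>\<^sub>\<infinity>n. rterm al u v (q ^ N) n)"
    unfolding 1[symmetric] 2 by (simp only: mult_ac)
  finally show ?thesis unfolding s2 .
qed

lemma holomorphic_lterm: "(\<lambda>x. lterm al u v x k) holomorphic_on S"
  unfolding lterm_def by (intro holomorphic_intros)

lemma holomorphic_rterm: "(\<lambda>x. rterm al u v x k) holomorphic_on S"
  unfolding rterm_def divide_inverse by (intro holomorphic_intros)

lemma entire_identity:
  assumes "al \<noteq> 0" "u \<noteq> 0" "v \<noteq> 0" and al: "\<And>m::int. al * q powi m \<noteq> 1"
    and conv: "norm (al * q * u * v) < 1" "norm (al * q * u * v) * norm x ^ 2 < 1"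
  shows "P (al * q * u * v) * P al * P (q / al) * P (q * x ^ 2) * (\<Sum>\<^sub>\<infinity>k. lterm al u v x k) =
    P (al * q * u * v * x) * P (q * x) * (\<Sum>\<^sub>\<infinity>n. rterm al u v x n)"
proof -
  define c where "c = norm (al * q * u * v)"
  have c: "c > 0" using assms q_nz by (simp add: c_def)
  \<comment> \<open>\<open>r^2\<close> is the midpoint of |x|^2 and 1/c, so \<open>x\<close> lies
    inside the open disc while the ratio \<open>c * r^2\<close> stays below 1.\<close>
  define r where "r = sqrt ((norm x ^ 2 + 1 / c) / 2)"
  have "norm x ^ 2 < 1 / c" using conv(2) c unfolding c_def[symmetric] by (simp add: field_simps)
  moreover have r2: "r ^ 2 = (norm x ^ 2 + 1 / c) / 2"
    unfolding r_def using c by (intro real_sqrt_pow2) simp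
  ultimately have "norm x ^ 2 < r ^ 2" "r ^ 2 < 1 / c"
    by simp_all
  moreover have "r \<ge> 0" unfolding r_def using c by simp
  ultimately have r: "norm x < r" "c * r ^ 2 < 1"
    using power_less_imp_less_base[of "norm x" 2 r] c by (simp_all add: field_simps)
  then have r0: "r > 0" using norm_ge_zero[of x] by linarith
  let ?f = "\<lambda>x. P (al * q * u * v) * P al * P (q / al) * P (q * x ^ 2) * (\<Sum>\<^sub>\<infinity>k. lterm al u v x k) -
    P (al * q * u * v * x) * P (q * x) * (\<Sum>\<^sub>\<infinity>n. rterm al u v x n)"
  have hl: "(\<lambda>x. \<Sum>\<^sub>\<infinity>k. lterm al u v x k) holomorphic_on ball 0 r"
    using r conv c unfolding c_def
    by (intro geom_bounded_holomorphic[OF geom_bounded_lterm[OF assms(1-3) r0]] holomorphic_lterm) (auto simp: le_max_iff_disj)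
  have hr: "(\<lambda>x. \<Sum>\<^sub>\<infinity>k. rterm al u v x k) holomorphic_on ball 0 r"
    using r conv c unfolding c_def
    by (intro geom_bounded_holomorphic[OF geom_bounded_rterm[OF assms(1-3) r0]] holomorphic_rterm) auto
  have "?f x = 0"
  \<comment> \<open>The radius may be below 1, so only those powers of \<open>q\<close> that lie in
    the disc are used; all but finitely many do.\<close>
  proof (rule analytic_continuation[of ?f "ball 0 r" "range (\<lambda>N. q ^ N) \<inter> ball 0 r" 0])
    show "?f holomorphic_on ball 0 r"
      by (intro holomorphic_intros hl hr)
    show "(0 :: complex) islimpt range (\<lambda>N. q ^ N) \<inter> ball 0 r"
      unfolding islimpt_approachable
    proof (intro allI impI)
      fix e :: real assume "e > 0"
      then have "min e r > 0" using r0 by simp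
      moreover have "(\<lambda>n. norm q ^ n) \<longlonglongrightarrow> 0"
        using norm_q by (intro LIMSEQ_power_zero) simp
      ultimately obtain N where "norm q ^ N < min e r"
        using order_tendstoD(2)[of _ "0::real" sequentially "min e r"] by (auto simp: eventually_sequentially)
      then show "\<exists>x'\<in>range (\<lambda>N. q ^ N) \<inter> ball 0 r. x' \<noteq> 0 \<and> dist x' 0 < e"
        using q_nz by (intro bexI[of _ "q ^ N"]) (auto simp: norm_power)
    qed
    show "?f z = 0" if "z \<in> range (\<lambda>N. q ^ N) \<inter> ball 0 r" for z
      using that identity_at_power[OF assms(1-3) al conv(1)] by auto
  qed (use r r0 in auto)
  then show ?thesis by simp
qed

subsection \<open>Passage to the bilateral hypergeometric series\<close>

lemma qpoch_0: "qpoch y q 0 = 1"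
  by (simp add: qpoch_def)

lemma qpoch_up:
  assumes "k \<ge> 0"
  shows "qpoch y q (k + 1) = qpoch y q k * (1 - y * q powi k)"
proof -
  have "nat (k + 1) = Suc (nat k)" using assms by simp
  then show ?thesis
    using assms by (simp add: qpoch_def power_int_nonneg_exp)
qed

lemma qpoch_down:
  assumes "k < 0"
  shows "qpoch y q k = qpoch y q (k + 1) / (1 - y * q powi k)"
proof -
  obtain m where m: "k = - int (Suc m)"
    using assms negD by blast
  have "(\<Prod>i<Suc m. 1 - y * q powi (k + int i)) = (1 - y * q powi k) * (\<Prod>i<m. 1 - y * q powi (k + 1 + int i))"
    by (subst prod.lessThan_Suc_shift) (simp add: add_ac)
  moreover have "nat (- k) = Suc m" "nat (- (k + 1)) = m" using m by auto
  ultimately show ?thesis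
    using assms m by (cases "m = 0") (simp_all add: qpoch_def)
qed

text \<open>Meant for upper parameters: those treated this way are 1/(xu), 1/(xv), al/x, 1/u and
  1/v, so passing to q/y makes the dependence on \<open>x\<close> entire. The recurrence step
  multiplies by \<open>1 - y * q^k\<close>, which the hypothesis allows to be cancelled for negative
  \<open>k\<close>.\<close>

lemma qpoch_mult_qpoch_inf:
  assumes "y \<noteq> 0" and y: "\<And>n. n \<ge> 1 \<Longrightarrow> 1 - y * q powi (- int n) \<noteq> 0"
  shows "qpoch y q k * P (q / y) = (- y) powi k * q powi tri k * P (q powi (1 - k) / y)"
proof -
  have step: "P (q powi (1 - (k + 1)) / y) * (- y * q powi k) = (1 - y * q powi k) * P (q powi (1 - k) / y)" for k
  proof -
    have 1: "P (q powi (- k) / y) = (1 - q powi (- k) / y) * P (q powi (1 - k) / y)"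
      using P_step[of "q powi (- k) / y"] q_nz by (simp add: power_int_diff power_int_minus field_simps)
    have 2: "- y * q powi k * (1 - q powi (- k) / y) = 1 - y * q powi k"
      using assms q_nz by (simp add: power_int_minus field_simps)
    have 3: "1 - (k + 1) = - k" by simp
    show ?thesis
      unfolding 3 1 2[symmetric] by (simp only: mult_ac)
  qed
  show ?thesis
  proof (induction k rule: int_induct[of _ 0])
    case base
    then show ?case by (simp add: qpoch_0)
  next
    case (step1 k)
    have "qpoch y q (k + 1) * P (q / y) = (1 - y * q powi k) * (qpoch y q k * P (q / y))"
      unfolding qpoch_up[OF step1(1)] by (simp only: mult_ac)
    also have "\<dots> = (- y) powi k * q powi tri k * (P (q powi (1 - (k + 1)) / y) * (- y * q powi k))"
      unfolding step1 step by (simp only: mult_ac)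
    also have "\<dots> = (- y) powi (k + 1) * q powi tri (k + 1) * P (q powi (1 - (k + 1)) / y)"
      using assms(1) q_nz by (simp add: tri_Suc power_int_add)
    finally show ?case .
  next
    case (step2 k)
    define m where "m = k - 1"
    have k: "k = m + 1" "m < 0" using step2 by (simp_all add: m_def)
    obtain n where "m = - int (Suc n)" using k(2) negD by blast
    then have nz: "1 - y * q powi m \<noteq> 0" using y[of "Suc n"] by simp
    have "(1 - y * q powi m) * (qpoch y q m * P (q / y)) = qpoch y q (m + 1) * P (q / y)"
      unfolding qpoch_down[OF k(2)] using nz by simp
    also have "\<dots> = (- y) powi (m + 1) * q powi tri (m + 1) * P (q powi (1 - (m + 1)) / y)"
      using step2 unfolding k(1) by simp
    also have "\<dots> = (- y) powi m * q powi tri m * (P (q powi (1 - (m + 1)) / y) * (- y * q powi m))"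
      using assms(1) q_nz by (simp add: tri_Suc power_int_add)
    also have "\<dots> = (1 - y * q powi m) * ((- y) powi m * q powi tri m * P (q powi (1 - m) / y))"
      unfolding step by (simp only: mult_ac)
    finally show ?case using nz unfolding m_def by simp
  qed
qed

text \<open>Meant for lower parameters. For negative \<open>k\<close> the finite product may vanish;
  then \<open>qpoch\<close> and its inverse are both 0 by \<open>inverse 0 = 0\<close>, in agreement
  with the zero of the right-hand side.\<close>

lemma inverse_qpoch:
  assumes "\<And>n. 1 - y * q ^ n \<noteq> 0"
  shows "inverse (qpoch y q k) * P y = P (y * q powi k)"
proof (cases "k \<ge> 0")
  case True
  have "qpoch_fin y (nat k) \<noteq> 0" using assms by (auto simp: qpoch_fin_def)
  moreover have "qpoch y q k = qpoch_fin y (nat k)" using True by (simp add: qpoch_def qpoch_fin_def)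
  moreover have "P y = qpoch_fin y (nat k) * P (y * q powi k)"
    using True P_split[of y "nat k"] by (simp add: power_int_nonneg_exp)
  ultimately show ?thesis by simp
next
  case False
  have shift: "y * q powi k * q ^ i = y * q powi (k + int i)" for i
    using q_nz by (simp add: power_int_add)
  have "qpoch y q k = 1 / qpoch_fin (y * q powi k) (nat (- k))"
    unfolding qpoch_fin_def shift using False by (simp add: qpoch_def)
  moreover have "y * q powi k * q ^ nat (- k) = y"
    unfolding shift using False by simp
  then have "P (y * q powi k) = qpoch_fin (y * q powi k) (nat (- k)) * P y"
    using P_split[of "y * q powi k" "nat (- k)"] by (simp only:)
  ultimately show ?thesis by simp
qed

text \<open>Here the choice of branch disappears. One step in \<open>k\<close> on the left gives (1
  - y q^(2k))(1 - y q^(2k+1)), that is, two steps on the right; at a pole both sides are 0 by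
  division by zero.\<close>

lemma qpoch_double:
  assumes "r ^ 2 = y * q" "s ^ 2 = y"
  shows "qpoch r q k * qpoch (- r) q k * qpoch s q k * qpoch (- s) q k = qpoch y q (2 * k)"
proof -
  have sq: "(1 - r * q powi k) * (1 - - r * q powi k) * (1 - s * q powi k) * (1 - - s * q powi k) =
      (1 - y * q powi (2 * k)) * (1 - y * q powi (2 * k + 1))" for k
  proof -
    have "q powi (2 * k) = (q powi k) ^ 2" "q powi (2 * k + 1) = (q powi k) ^ 2 * q"
      using q_nz by (simp_all add: power_int_add power_int_power' mult.commute)
    then show ?thesis using assms by algebra
  qed
  show ?thesis
  proof (induction k rule: int_induct[of _ 0])
    case base
    then show ?case by (simp add: qpoch_0)
  next
    case (step1 k)
    have "qpoch y q (2 * (k + 1)) = qpoch y q (2 * k) * ((1 - y * q powi (2 * k)) * (1 - y * q powi (2 * k + 1)))"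
    proof -
      have e: "2 * (k + 1) = 2 * k + 1 + 1" by simp
      have "0 \<le> 2 * k" "0 \<le> 2 * k + 1" using step1(1) by auto
      then show ?thesis unfolding e by (simp only: qpoch_up mult.assoc)
    qed
    then show ?case
      unfolding qpoch_up[OF step1(1)] sq[symmetric] step1(2)[symmetric] by (simp only: mult_ac)
  next
    case (step2 k)
    define m where "m = k - 1"
    have k: "k = m + 1" "m < 0" using step2 by (simp_all add: m_def)
    have "qpoch y q (2 * m) = qpoch y q (2 * (m + 1)) / ((1 - y * q powi (2 * m)) * (1 - y * q powi (2 * m + 1)))"
      using qpoch_down[of "2 * m" y] qpoch_down[of "2 * m + 1" y] k(2) by (simp add: algebra_simps)
    also have "qpoch y q (2 * (m + 1)) = qpoch r q (m + 1) * qpoch (- r) q (m + 1) * qpoch s q (m + 1) * qpoch (- s) q (m + 1)"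
      using step2 unfolding k(1) by simp
    finally show ?case
      unfolding m_def[symmetric] qpoch_down[OF k(2)] sq[symmetric] by simp
  qed
qed

text \<open>Taken at \<open>rax\<close> and \<open>- rax\<close>, the two ratios multiply to the
  very-well-poised factor (1 - al q^(2k))/(1 - al).\<close>

lemma qpoch_shift_ratio:
  assumes "\<And>m::int. y * q powi m \<noteq> 1"
  shows "qpoch (q * y) q k / qpoch y q k = (1 - y * q powi k) / (1 - y)"
proof (induction k rule: int_induct[of _ 0])
  case base
  then show ?case using assms[of 0] by (simp add: qpoch_0)
next
  case (step1 k)
  have "q * y * q powi k = y * q powi (k + 1)"
    using q_nz by (simp add: power_int_add)
  then have "qpoch (q * y) q (k + 1) / qpoch y q (k + 1) =
      (qpoch (q * y) q k / qpoch y q k) * ((1 - y * q powi (k + 1)) / (1 - y * q powi k))"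
    unfolding qpoch_up[OF step1(1)] by simp
  then show ?case unfolding step1(2) using assms[of k] by simp
next
  case (step2 k)
  define m where "m = k - 1"
  have k: "k = m + 1" "m < 0" using step2 by (simp_all add: m_def)
  have "q * y * q powi m = y * q powi k"
    using q_nz unfolding k(1) by (simp add: power_int_add)
  then have "qpoch (q * y) q m / qpoch y q m =
      (qpoch (q * y) q k / qpoch y q k) * ((1 - y * q powi m) / (1 - y * q powi k))"
    unfolding qpoch_down[OF k(2)] k(1) by simp
  then show ?case unfolding step2(2) m_def[symmetric] using assms[of k] by simp
qed

end

text \<open>Every term of the two series is a constant, \<open>CL\<close> or \<open>CR\<close>,
  times \<open>lterm\<close> or \<open>rterm\<close>, so \<open>entire_identity\<close> relates the
  two sums. The stated prefactor is what remains of \<open>CL\<close> / \<open>CR\<close> and the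
  products in that identity, with P(al) = (1 - al) P(al q).\<close>

theorem theorem1:
  fixes q a b c x :: complex
    and rax raq ra :: complex
  assumes "norm q < 1"
    and "q \<noteq> 0" and "a \<noteq> 0" and "b \<noteq> 0" and "c \<noteq> 0" and "x \<noteq> 0"
    and "max (norm (a * q / (b * c * x))) (norm (a * q * x / (b * c))) < 1"
    and "rax ^ 2 = a * x" and "raq ^ 2 = a * q" and "ra ^ 2 = a"
    and "bilateral_nonsingular [b, c] [a * q / b, a * q / c] q"
    and "bilateral_nonsingular
           [q * rax, - q * rax, raq, - raq, ra, - ra, b * x, c * x]
           [rax, - rax, x * raq, - x * raq, x * q * ra, - x * q * ra, a * q / b, a * q / c] q"
    and "\<forall>y\<in>{q / b, q / c, a * q / (b * c * x), q / (a * x), a * q * x, q * x ^ 2}.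
           qpoch_inf y q \<noteq> 0"
  shows "bilateral_psi [b, c] [a * q / b, a * q / c] q (a * q * x / (b * c)) =
           qpochs_inf [q / a, a * q / (b * c), q / (b * x), q / (c * x), q * x, a * q * x ^ 2] q /
           qpochs_inf [q / b, q / c, a * q / (b * c * x), q / (a * x), a * q * x, q * x ^ 2] q *
           bilateral_psi
             [q * rax, - q * rax, raq, - raq, ra, - ra, b * x, c * x]
             [rax, - rax, x * raq, - x * raq, x * q * ra, - x * q * ra, a * q / b, a * q / c]
             q (a * q * x / (b * c))"
proof -
  interpret q_base q
    using assms(1,2) by unfold_locales
  note q_nz = assms(2)
  define al u v z where "al = a * x" and "u = 1 / (b * x)" and "v = 1 / (c * x)" and "z = a * q * x / (b * c)"
  have nz: "al \<noteq> 0" "u \<noteq> 0" "v \<noteq> 0"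
    using assms(3-6) by (simp_all add: al_def u_def v_def)
  have upper: "1 - y * q powi (- int n) \<noteq> 0"
    if "y \<in> {b, c, q * rax, - q * rax, raq, - raq, ra, - ra, b * x, c * x}" "n \<ge> 1" for y n
    using assms(11,12) that unfolding bilateral_nonsingular_def by auto
  have lower: "1 - y * q ^ n \<noteq> 0"
    if "y \<in> {rax, - rax, x * raq, - x * raq, x * q * ra, - x * q * ra, a * q / b, a * q / c}" for y n
    using assms(12) that unfolding bilateral_nonsingular_def by auto
  have rax: "rax * q powi m \<noteq> 1" "- rax * q powi m \<noteq> 1" for m :: int
  proof -
    have "y * q powi m \<noteq> 1" if y: "y \<in> {rax, - rax}" for y
    proof (cases "m \<ge> 0")
      case True
      then show ?thesis using lower[of y "nat m"] y by (auto simp: power_int_nonneg_exp)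
    next
      case False
      then obtain n where n: "m = - int (Suc n)" using negD by (metis not_le)
      \<comment> \<open>As an upper parameter only \<open>q * rax\<close> occurs, so a negative
        power on \<open>rax\<close> is read as a power one lower on \<open>q * rax\<close>.\<close>
      have "m = 1 + - int (Suc (Suc n))" using n by simp
      then have "q powi m = q powi 1 * q powi (- int (Suc (Suc n)))"
        by (simp only: power_int_add[OF disjI1[OF q_nz]])
      then have "y * q powi m = (q * y) * q powi (- int (Suc (Suc n)))"
        by (simp only: power_int_1_right) (simp only: mult_ac)
      moreover have "q * y \<in> {q * rax, - q * rax}" using y by auto
      ultimately show ?thesis using upper[of "q * y" "Suc (Suc n)"] by (metis insert_iff le_add1 plus_1_eq_Suc right_minus_eq)
    qed
    from this[of rax] this[of "- rax"] show "rax * q powi m \<noteq> 1" "- rax * q powi m \<noteq> 1"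
      by simp_all
  qed
  have even_pow: "q powi (2 * m) = (q powi m) ^ 2" for m
    by (simp add: power_int_power' mult.commute)
  have half: "y ^ 2 * q powi (2 * m) \<noteq> 1"
    if "1 - y * q powi m \<noteq> 0" "1 - - y * q powi m \<noteq> 0" for y m
  proof -
    have "(1 - y * q powi m) * (1 - - y * q powi m) = 1 - y ^ 2 * q powi (2 * m)"
      unfolding even_pow by algebra
    then show ?thesis using that by (metis mult_eq_0_iff right_minus_eq)
  qed
  have al_even: "al * q powi (2 * m) \<noteq> 1" for m
  proof -
    have "1 - rax * q powi m \<noteq> 0" "1 - - rax * q powi m \<noteq> 0"
      using rax[of m] by (metis right_minus_eq)+
    from half[OF this] show ?thesis using assms(8) by (simp add: al_def)
  qed
  have P_nz: "P (q / b) \<noteq> 0" "P (q / c) \<noteq> 0" "P (a * q / (b * c * x)) \<noteq> 0" "P (q / al) \<noteq> 0"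
      "P (al * q) \<noteq> 0" "P (q * x ^ 2) \<noteq> 0"
    using assms(13) by (simp_all add: al_def mult_ac)
  have zero: "P y = 0" if "y * q ^ n = 1" for y n
    using P_split[of y "Suc n"] that by (simp add: qpoch_fin_Suc)
  have al: "al * q powi m \<noteq> 1" for m :: int
  proof
    assume eq: "al * q powi m = 1"
    \<comment> \<open>Positive and negative \<open>m\<close> are excluded by
      \<open>P (al * q)\<close> and \<open>P (q / al)\<close> being nonzero; \<open>m = 0\<close>
      comes from the conditions on \<open>rax\<close>.\<close>
    consider "m = 0" | n where "m = int (Suc n)" | n where "m = - int (Suc n)"
      by (metis int_cases2 of_nat_0 minus_zero not0_implies_Suc)
    then show False
    proof cases
      case 1
      then show ?thesis using eq al_even[of 0] by simp
    next
      case (2 n)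
      then have "al * q * q ^ n = 1" using eq unfolding 2 power_int_of_nat by (simp add: mult.assoc)
      then show ?thesis using zero P_nz by blast
    next
      case (3 n)
      then have "q / al * q ^ n = 1"
        using eq nz q_nz unfolding 3 power_int_minus power_int_of_nat by (simp add: field_simps)
      then show ?thesis using zero P_nz by blast
    qed
  qed
  \<comment> \<open>The hypotheses concern the square roots: even \<open>n\<close> follows from
    \<open>ra\<close> and \<open>- ra\<close>, odd \<open>n\<close> from \<open>raq\<close> and
    \<open>- raq\<close>.\<close>
  have a_upper: "1 - a * q powi (- int n) \<noteq> 0" if "n \<ge> 1" for n
  proof -
    have "a * q powi (- int n) \<noteq> 1"
    proof (cases "even n")
      case True
      then obtain m where m: "n = 2 * m" by blast
      then have "m \<ge> 1" using that by simp
      then have "1 - ra * q powi (- int m) \<noteq> 0" "1 - - ra * q powi (- int m) \<noteq> 0"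
        by (intro upper; simp)+
      from half[OF this] show ?thesis using assms(10) by (simp add: m)
    next
      case False
      then obtain m where m: "n = 2 * m + 1" by (elim oddE)
      have "a * q powi (- int n) = raq ^ 2 * q powi (2 * (- int (Suc m)))"
        unfolding assms(9) m using q_nz by (simp add: power_int_minus power_int_diff power_int_add field_simps) (simp add: power2_eq_square)
      moreover have "1 - raq * q powi (- int (Suc m)) \<noteq> 0" "1 - - raq * q powi (- int (Suc m)) \<noteq> 0"
        by (intro upper; simp)+
      ultimately show ?thesis using half by (simp only:) blast
    qed
    then show ?thesis by simp
  qed
  \<comment> \<open>The four lower parameters built from \<open>x * raq\<close> and
    \<open>x * q * ra\<close> combine to (e; q)_(2k).\<close>
  define e where "e = a * q * x ^ 2"
  have e_lower: "1 - e * q ^ n \<noteq> 0" for n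
  proof -
    have "e * q ^ n \<noteq> 1"
    proof (cases "even n")
      case True
      then obtain m where m: "n = 2 * m" by blast
      have "e * q ^ n = (x * raq) ^ 2 * q powi (2 * int m)"
        unfolding even_pow power_mult_distrib assms(9) m by (simp add: e_def power_mult power_mult_distrib power2_eq_square)
      moreover have "1 - x * raq * q powi int m \<noteq> 0" "1 - - (x * raq) * q powi int m \<noteq> 0"
        using lower[of "x * raq" m] lower[of "- x * raq" m] by simp_all
      ultimately show ?thesis using half by (simp only:) blast
    next
      case False
      then obtain m where m: "n = 2 * m + 1" by (elim oddE)
      have "e * q ^ n = (x * q * ra) ^ 2 * q powi (2 * int m)"
        unfolding even_pow power_mult_distrib assms(10) m by (simp add: e_def power_mult power_mult_distrib power2_eq_square)
      moreover have "1 - x * q * ra * q powi int m \<noteq> 0" "1 - - (x * q * ra) * q powi int m \<noteq> 0"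
        using lower[of "x * q * ra" m] lower[of "- x * q * ra" m] by simp_all
      ultimately show ?thesis using half by (simp only:) blast
    qed
    then show ?thesis by simp
  qed
  have upper_nz: "P (q / y) \<noteq> 0" if "y \<noteq> 0" "\<And>n. n \<ge> 1 \<Longrightarrow> 1 - y * q powi (- int n) \<noteq> 0" for y
  proof (rule qpoch_inf_nonzero)
    show "q / y * q ^ i \<noteq> 1" for i
      using that(1) that(2)[of "Suc i"] q_nz unfolding power_int_minus power_int_of_nat
      by (auto simp: field_simps)
  qed
  have lower_nz: "P y \<noteq> 0" if "\<And>n. 1 - y * q ^ n \<noteq> 0" for y
    using that by (intro qpoch_inf_nonzero) (metis right_minus_eq)
  have P_nz': "P (q / a) \<noteq> 0" "P e \<noteq> 0" "P (q / (b * x)) \<noteq> 0" "P (q / (c * x)) \<noteq> 0"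
      "P (a * q / b) \<noteq> 0" "P (a * q / c) \<noteq> 0"
    using upper_nz[OF assms(3) a_upper] upper_nz[of "b * x", OF _ upper] upper_nz[of "c * x", OF _ upper]
      lower_nz[OF e_lower] lower_nz[of "a * q / b", OF lower] lower_nz[of "a * q / c", OF lower] assms(4-6)
    by simp_all
  have up: "qpoch y q k = (- y) powi k * q powi tri k * P (q powi (1 - k) / y) / P (q / y)"
    if "y \<noteq> 0" "\<And>n. n \<ge> 1 \<Longrightarrow> 1 - y * q powi (- int n) \<noteq> 0" for y k
    using qpoch_mult_qpoch_inf[OF that] upper_nz[OF that] by (simp add: field_simps)
  have lo: "inverse (qpoch y q k) = P (y * q powi k) / P y" if "\<And>n. 1 - y * q ^ n \<noteq> 0" for y k
    using inverse_qpoch[OF that] lower_nz[OF that] by (simp add: field_simps)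
  have tri2: "q powi tri k * q powi tri k = q powi (k ^ 2 - k)" for k
  proof -
    have "tri k + tri k = k ^ 2 - k"
      unfolding tri_def by (simp add: power2_eq_square algebra_simps)
    then show ?thesis using q_nz by (simp flip: power_int_add)
  qed
  have xu: "x * u = 1 / b" "x * v = 1 / c" "al * u = a / b" "al * v = a / c" "x / al = 1 / a"
    using assms(3-6) by (simp_all add: u_def v_def al_def)
  have low_arg: "a * q / y * q powi k = q powi (1 + k) * (a / y)" for y k
    using q_nz by (simp add: power_int_add)

  define CL where "CL = inverse (P (q / b) * P (q / c) * P (a * q / b) * P (a * q / c))"
  have term_l: "qpochs [b, c] q k / qpochs [a * q / b, a * q / c] q k * z powi k = CL * lterm al u v x k" for k
  proof -
    have "(- b) powi k * (- c) powi k * z powi k = (al * q) powi k"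
    proof -
      have "- b * - c * z = al * q" using assms(4,5) by (simp add: z_def al_def)
      then show ?thesis by (metis power_int_mult_distrib)
    qed
    then have pw: "(- b) powi k * (- c) powi k * z powi k * (q powi tri k * q powi tri k) = al powi k * q powi (k ^ 2)"
      unfolding tri2 using q_nz by (simp add: power_int_mult_distrib power_int_diff)
    have "qpochs [b, c] q k / qpochs [a * q / b, a * q / c] q k * z powi k =
        qpoch b q k * qpoch c q k * inverse (qpoch (a * q / b) q k) * inverse (qpoch (a * q / c) q k) * z powi k"
      by (simp add: qpochs_def divide_inverse)
    also have "\<dots> = CL * (((- b) powi k * (- c) powi k * z powi k * (q powi tri k * q powi tri k)) *
        (P (q powi (1 - k) / b) * P (q powi (1 - k) / c) * P (a * q / b * q powi k) * P (a * q / c * q powi k)))"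
      using upper[of b] upper[of c] lower[of "a * q / b"] lower[of "a * q / c"] assms(4,5)
      by (simp add: up lo CL_def divide_inverse)
    also have "\<dots> = CL * lterm al u v x k"
      unfolding pw lterm_def xu low_arg by simp
    finally show ?thesis .
  qed

  define CR where "CR = inverse ((1 - al) * P (q / a) * P e * P (q / (b * x)) * P (q / (c * x)) *
    P (a * q / b) * P (a * q / c))"
  let ?A = "[q * rax, - q * rax, raq, - raq, ra, - ra, b * x, c * x]"
  let ?B = "[rax, - rax, x * raq, - x * raq, x * q * ra, - x * q * ra, a * q / b, a * q / c]"
  have term_r: "qpochs ?A q k / qpochs ?B q k * z powi k = CR * rterm al u v x k" for k
  proof -
    have r: "(qpoch (q * rax) q k / qpoch rax q k) * (qpoch (q * - rax) q k / qpoch (- rax) q k) =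
        (1 - al * q powi (2 * k)) * inverse (1 - al)"
    proof -
      have "(1 - rax * q powi k) * (1 - - rax * q powi k) = 1 - al * q powi (2 * k)"
        "(1 - rax) * (1 - - rax) = 1 - al"
        using assms(8) unfolding al_def even_pow by algebra+
      then show ?thesis
        unfolding qpoch_shift_ratio[OF rax(1)] qpoch_shift_ratio[OF rax(2)] times_divide_times_eq
        by (simp only: divide_inverse)
    qed
    have d1: "qpoch raq q k * qpoch (- raq) q k * qpoch ra q k * qpoch (- ra) q k = qpoch a q (2 * k)"
      by (rule qpoch_double) (use assms(9,10) in auto)
    \<comment> \<open>The roles are swapped compared with \<open>d1\<close>: here the root of
      \<open>e * q\<close> is \<open>x * q * ra\<close>, and that of \<open>e\<close> is
      \<open>x * raq\<close>.\<close>
    have d2: "qpoch (x * q * ra) q k * qpoch (- (x * q * ra)) q k * qpoch (x * raq) q k * qpoch (- (x * raq)) q k = qpoch e q (2 * k)"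
      by (rule qpoch_double) (use assms(9,10) in \<open>simp_all add: e_def power_mult_distrib power2_eq_square\<close>)
    have "qpochs ?A q k / qpochs ?B q k * z powi k =
       ((qpoch (q * rax) q k / qpoch rax q k) * (qpoch (q * - rax) q k / qpoch (- rax) q k)) *
       (qpoch raq q k * qpoch (- raq) q k * qpoch ra q k * qpoch (- ra) q k) *
       inverse (qpoch (x * q * ra) q k * qpoch (- (x * q * ra)) q k * qpoch (x * raq) q k * qpoch (- (x * raq)) q k) *
       qpoch (b * x) q k * qpoch (c * x) q k *
       inverse (qpoch (a * q / b) q k) * inverse (qpoch (a * q / c) q k) * z powi k"
      by (simp add: qpochs_def divide_inverse)
    also have "\<dots> = (1 - al * q powi (2 * k)) * inverse (1 - al) * qpoch a q (2 * k) * inverse (qpoch e q (2 * k)) *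
       qpoch (b * x) q k * qpoch (c * x) q k *
       inverse (qpoch (a * q / b) q k) * inverse (qpoch (a * q / c) q k) * z powi k"
      unfolding r d1 d2 ..
    also have "\<dots> = CR * ((1 - al * q powi (2 * k)) *
        ((- a) powi (2 * k) * q powi tri (2 * k) * ((- (b * x)) powi k * (- (c * x)) powi k * z powi k) *
          (q powi tri k * q powi tri k)) *
        (P (q powi (1 - 2 * k) / a) * P (e * q powi (2 * k)) * P (q powi (1 - k) / (b * x)) * P (q powi (1 - k) / (c * x)) *
         P (a * q / b * q powi k) * P (a * q / c * q powi k)))"
      using upper[of "b * x"] upper[of "c * x"] lower[of "a * q / b"] lower[of "a * q / c"] assms(3-6) a_upper e_lower
      by (simp add: up lo CR_def divide_inverse)
    also have "(- (b * x)) powi k * (- (c * x)) powi k * z powi k = (al * q * x ^ 2) powi k"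
    proof -
      have "- (b * x) * - (c * x) * z = al * q * x ^ 2"
        using assms(4,5) by (simp add: z_def al_def power2_eq_square)
      then show ?thesis by (metis power_int_mult_distrib)
    qed
    also have "(- a) powi (2 * k) * q powi tri (2 * k) * (al * q * x ^ 2) powi k * (q powi tri k * q powi tri k) =
        al powi (3 * k) * q powi (3 * k ^ 2 - k)"
    proof -
      have p: "(- a) powi (2 * k) = (a ^ 2) powi k" "al powi (3 * k) = (al ^ 3) powi k"
        by (simp_all add: power_int_mult)
      have f1: "(a ^ 2) powi k * (al * q * x ^ 2) powi k = al powi (3 * k) * q powi k"
      proof -
        have "a ^ 2 * (al * q * x ^ 2) = al ^ 3 * q"
          by (simp add: al_def power2_eq_square power3_eq_cube)
        then show ?thesis unfolding p by (metis power_int_mult_distrib)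
      qed
      have f2: "q powi tri (2 * k) * q powi k * q powi (k ^ 2 - k) = q powi (3 * k ^ 2 - k)"
      proof -
        have "tri (2 * k) + k + (k ^ 2 - k) = 3 * k ^ 2 - k"
          unfolding tri_double by (simp add: power2_eq_square algebra_simps)
        then show ?thesis using q_nz by (metis power_int_add)
      qed
      have "(a ^ 2) powi k * q powi tri (2 * k) * (al * q * x ^ 2) powi k * q powi (k ^ 2 - k) =
          ((a ^ 2) powi k * (al * q * x ^ 2) powi k) * (q powi tri (2 * k) * q powi (k ^ 2 - k))"
        by (simp only: mult_ac)
      then show ?thesis
        unfolding tri2 p(1) f1 f2[symmetric] by (simp only: mult_ac)
    qed
    also have "CR * ((1 - al * q powi (2 * k)) * (al powi (3 * k) * q powi (3 * k ^ 2 - k)) *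
        (P (q powi (1 - 2 * k) / a) * P (e * q powi (2 * k)) * P (q powi (1 - k) / (b * x)) * P (q powi (1 - k) / (c * x)) *
         P (a * q / b * q powi k) * P (a * q / c * q powi k))) = CR * rterm al u v x k"
    proof -
      have "e * q powi (2 * k) = q powi (1 + 2 * k) * (x * al)"
        using q_nz by (simp add: e_def al_def power_int_add power2_eq_square)
      then show ?thesis
        unfolding rterm_def xu low_arg unfolding u_def v_def by simp
    qed
    finally show ?thesis .
  qed

  have arg1: "al * q * u * v = a * q / (b * c * x)" and arg2: "al * q * u * v * x = a * q / (b * c)"
    using assms(6) by (simp_all add: al_def u_def v_def)
  define L R where "L = (\<Sum>\<^sub>\<infinity>k. lterm al u v x k)" and "R = (\<Sum>\<^sub>\<infinity>k. rterm al u v x k)"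
  \<comment> \<open>With \<open>arg1\<close>, the two bounds in the maximum become exactly the two
    convergence conditions of \<open>entire_identity\<close>.\<close>
  have "norm (al * q * u * v) * norm x ^ 2 = norm (a * q * x / (b * c))"
    unfolding arg1 using assms(6) by (simp add: norm_mult norm_divide power2_eq_square)
  then have "P (al * q * u * v) * P al * P (q / al) * P (q * x ^ 2) * L =
      P (al * q * u * v * x) * P (q * x) * R"
    unfolding L_def R_def using assms(7) arg1 by (intro entire_identity nz al) auto
  then have main: "P (a * q / (b * c * x)) * ((1 - al) * P (al * q)) * P (q / al) * P (q * x ^ 2) * L =
      P (a * q / (b * c)) * P (q * x) * R"
    unfolding arg2 unfolding arg1 using P_step[of al] by simp
  have psi_l: "bilateral_psi [b, c] [a * q / b, a * q / c] q z = CL * L"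
    unfolding bilateral_psi_def term_l L_def by (rule infsum_cmult_right')
  have psi_r: "bilateral_psi ?A ?B q z = CR * R"
    unfolding bilateral_psi_def term_r R_def by (rule infsum_cmult_right')
  have quot: "CL * L = P (q / a) * P (a * q / (b * c)) * P (q / (b * x)) * P (q / (c * x)) * P (q * x) * P e /
     (P (q / b) * P (q / c) * P (a * q / (b * c * x)) * P (q / al) * P (al * q) * P (q * x ^ 2)) * (CR * R)"
  proof -
    have cancel: "inverse (B1 * B2 * G1 * G2) * L' =
       A1 * H * X1 * X2 * Y * E1 / (B1 * B2 * K * T * S * V) * (inverse (D * A1 * E1 * X1 * X2 * G1 * G2) * R')"
      if "K * (D * S) * T * V * L' = H * Y * R'" "B1 \<noteq> 0" "B2 \<noteq> 0" "G1 \<noteq> 0" "G2 \<noteq> 0" "A1 \<noteq> 0" "X1 \<noteq> 0" "X2 \<noteq> 0"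
        "E1 \<noteq> 0" "K \<noteq> 0" "T \<noteq> 0" "S \<noteq> 0" "V \<noteq> 0" "D \<noteq> 0"
      for B1 B2 G1 G2 L' A1 H X1 X2 Y E1 K T S V D R' :: complex
    proof -
      have "A1 * H * X1 * X2 * Y * E1 / (B1 * B2 * K * T * S * V) * (inverse (D * A1 * E1 * X1 * X2 * G1 * G2) * R') =
        H * Y * R' / (B1 * B2 * G1 * G2 * (K * (D * S) * T * V))"
        using that(2-) by (simp add: divide_simps)
      also have "\<dots> = inverse (B1 * B2 * G1 * G2) * L'"
        unfolding that(1)[symmetric] using that(2-) by (simp add: divide_simps)
      finally show ?thesis ..
    qed
    show ?thesis
      unfolding CL_def CR_def by (rule cancel[OF main]) (use P_nz P_nz' al[of 0] in auto)
  qed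
  have prefactor: "qpochs_inf [q / a, a * q / (b * c), q / (b * x), q / (c * x), q * x, a * q * x ^ 2] q /
      qpochs_inf [q / b, q / c, a * q / (b * c * x), q / (a * x), a * q * x, q * x ^ 2] q =
      P (q / a) * P (a * q / (b * c)) * P (q / (b * x)) * P (q / (c * x)) * P (q * x) * P e /
     (P (q / b) * P (q / c) * P (a * q / (b * c * x)) * P (q / al) * P (al * q) * P (q * x ^ 2))"
    by (simp add: qpochs_inf_def e_def al_def mult_ac)
  show ?thesis
    unfolding prefactor z_def[symmetric] psi_l psi_r by (rule quot)
qed

end
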